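(* Let $k$ be a field and $G$ a finite simple graph which is claw free and whose complement $G^c$ has no induced $4$-cycle. Then the edge ideal $I(G)=(x_ix_j:\ \{i,j\}\in E(G))\subseteq k[x_v: v\in V(G)]$ satisfies $\operatorname{reg}(I(G))\leq 3$.
   Context: $G^c$ is the graph on $V(G)$ whose edges are the non-edges of $G$. A graph is claw free if it has no $4$ vertices on which the induced subgraph is a star $K_{1,3}$. $\operatorname{reg}$ denotes Castelnuovo–Mumford regularity. *)

theory Defs
  imports
    "HOL-Library.Poly_Mapping"
    "HOL-Library.Extended_Real"
    "HOL-Algebra.Ideal"
    "Jordan_Normal_Form.Matrix_Kernel"
begin

section \<open>Finite simple graphs\<close>

text \<open>A graph is given by its vertex set \<open>V\<close> and its set \<open>E\<close> of two-element edges.\<close>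

definition simple_graph :: "'v set \<Rightarrow> 'v set set \<Rightarrow> bool" where
  "simple_graph V E \<longleftrightarrow> finite V \<and> E \<subseteq> {e. e \<subseteq> V \<and> card e = 2}"

definition complement_edges :: "'v set \<Rightarrow> 'v set set \<Rightarrow> 'v set set" where
  "complement_edges V E = {e. e \<subseteq> V \<and> card e = 2 \<and> e \<notin> E}"

definition induced_edges :: "'v set set \<Rightarrow> 'v set \<Rightarrow> 'v set set" where
  "induced_edges E W = {e \<in> E. e \<subseteq> W}"

definition claw_free :: "'v set \<Rightarrow> 'v set set \<Rightarrow> bool" where
  "claw_free V E \<longleftrightarrow>
     \<not> (\<exists>W \<subseteq> V. card W = 4 \<and> (\<exists>c \<in> W. induced_edges E W = {{c, w} | w. w \<in> W - {c}}))"

definition has_induced_4_cycle :: "'v set \<Rightarrow> 'v set set \<Rightarrow> bool" where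
  "has_induced_4_cycle V E \<longleftrightarrow>
     (\<exists>a b c d. {a, b, c, d} \<subseteq> V \<and> card {a, b, c, d} = 4 \<and>
        induced_edges E {a, b, c, d} = {{a, b}, {b, c}, {c, d}, {d, a}})"


section \<open>Polynomial rings\<close>

text \<open>
  A monomial is a finitely supported exponent function \<open>'v \<Rightarrow>\<^sub>0 nat\<close>, a polynomial is a finitely
  supported coefficient function on monomials.  The ring \<open>k[x\<^sub>v : v \<in> V]\<close> consists of the
  polynomials in which only indeterminates indexed by \<open>V\<close> occur.
\<close>

type_synonym ('v, 'k) mpol = "('v \<Rightarrow>\<^sub>0 nat) \<Rightarrow>\<^sub>0 'k"

definition polys :: "'v set \<Rightarrow> ('v, 'k::field) mpol set" where
  "polys V = {p. \<forall>m \<in> Poly_Mapping.keys p. Poly_Mapping.keys m \<subseteq> V}"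

definition poly_ring :: "'v set \<Rightarrow> ('v, 'k::field) mpol ring" where
  "poly_ring V = \<lparr>carrier = polys V, mult = (*), one = 1, zero = 0, add = (+)\<rparr>"

definition var :: "'v \<Rightarrow> ('v, 'k::field) mpol" where
  "var v = Poly_Mapping.single (Poly_Mapping.single v 1) 1"

definition monom_deg :: "('v \<Rightarrow>\<^sub>0 nat) \<Rightarrow> nat" where
  "monom_deg m = (\<Sum>v \<in> Poly_Mapping.keys m. Poly_Mapping.lookup m v)"

text \<open>The zero polynomial is homogeneous of every degree.\<close>

definition homogeneous :: "int \<Rightarrow> ('v, 'k::field) mpol \<Rightarrow> bool" where
  "homogeneous d p \<longleftrightarrow> (\<forall>m \<in> Poly_Mapping.keys p. int (monom_deg m) = d)"

definition irrelevant_ideal :: "'v set \<Rightarrow> ('v, 'k::field) mpol set" where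
  "irrelevant_ideal V = Idl\<^bsub>poly_ring V\<^esub> (var ` V)"

definition edge_ideal :: "'v set \<Rightarrow> 'v set set \<Rightarrow> ('v, 'k::field) mpol set" where
  "edge_ideal V E = Idl\<^bsub>poly_ring V\<^esub> {var i * var j | i j. {i, j} \<in> E}"

lemma polys_closed:
  shows "0 \<in> polys V" "1 \<in> polys V"
    and "p \<in> polys V \<Longrightarrow> q \<in> polys V \<Longrightarrow> p + q \<in> polys V"
    and "p \<in> polys V \<Longrightarrow> - p \<in> polys V"
    and "p \<in> polys V \<Longrightarrow> q \<in> polys V \<Longrightarrow> p * q \<in> polys V"
proof -
  show "0 \<in> polys V" "1 \<in> polys V" by (auto simp: polys_def)
  show "- p \<in> polys V" if "p \<in> polys V"
    using that by (auto simp: polys_def in_keys_iff)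
  show "p + q \<in> polys V" if "p \<in> polys V" "q \<in> polys V"
    using that Poly_Mapping.keys_add[of p q] by (auto simp: polys_def)
  show "p * q \<in> polys V" if "p \<in> polys V" "q \<in> polys V"
    unfolding polys_def
  proof (intro CollectI ballI)
    fix m assume "m \<in> Poly_Mapping.keys (p * q)"
    then obtain a b where "m = a + b" "a \<in> Poly_Mapping.keys p" "b \<in> Poly_Mapping.keys q"
      using keys_mult[of p q] by auto
    then show "Poly_Mapping.keys m \<subseteq> V"
      using that Poly_Mapping.keys_add[of a b] unfolding polys_def by blast
  qed
qed

lemma cring_poly_ring: "cring (poly_ring V)"
proof (rule cringI)
  show "abelian_group (poly_ring V)"
  proof (rule abelian_groupI)
    fix x assume "x \<in> carrier (poly_ring V)"
    then show "\<exists>y \<in> carrier (poly_ring V). y \<oplus>\<^bsub>poly_ring V\<^esub> x = \<zero>\<^bsub>poly_ring V\<^esub>"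
      by (intro bexI[of _ "- x"]) (auto simp: poly_ring_def polys_closed)
  qed (auto simp: poly_ring_def polys_closed algebra_simps)
  show "comm_monoid (poly_ring V)"
    by (rule comm_monoidI) (auto simp: poly_ring_def polys_closed algebra_simps)
qed (auto simp: poly_ring_def algebra_simps)


section \<open>Graded free resolutions and regularity\<close>

text \<open>The free module of rank \<open>n\<close> over \<open>k[x\<^sub>v : v \<in> V]\<close>, as column vectors.\<close>

definition free_mod :: "'v set \<Rightarrow> nat \<Rightarrow> ('v, 'k::field) mpol vec set" where
  "free_mod V n = {x \<in> carrier_vec n. set\<^sub>v x \<subseteq> polys V}"

text \<open>
  A graded free resolution \<open>\<dots> \<rightarrow> F\<^sub>1 \<rightarrow> F\<^sub>0 \<rightarrow> I \<rightarrow> 0\<close> of an ideal \<open>I\<close> of \<open>S = k[x\<^sub>v : v \<in> V]\<close>.  The module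
  \<open>F\<^sub>i\<close> is free of rank \<open>n i\<close>, and its basis element number \<open>l < n i\<close> has degree \<open>a i l\<close>, that is,
  \<open>F\<^sub>i\<close> is the direct sum of the \<open>S(-a i l)\<close>.  The matrix \<open>D 0\<close> is the augmentation \<open>F\<^sub>0 \<rightarrow> I \<subseteq> S\<close>
  (a row), and \<open>D (i + 1)\<close> is the differential from \<open>F\<^sub>i\<^sub>+\<^sub>1\<close> to \<open>F\<^sub>i\<close>.  The maps preserve degrees.
\<close>

definition graded_free_resolution ::
  "'v set \<Rightarrow> ('v, 'k::field) mpol set \<Rightarrow>
   (nat \<Rightarrow> nat) \<Rightarrow> (nat \<Rightarrow> nat \<Rightarrow> int) \<Rightarrow> (nat \<Rightarrow> ('v, 'k) mpol mat) \<Rightarrow> bool" where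
  "graded_free_resolution V I n a D \<longleftrightarrow>
     D 0 \<in> carrier_mat 1 (n 0) \<and>
     (\<forall>i. D (Suc i) \<in> carrier_mat (n i) (n (Suc i))) \<and>
     (\<forall>i. elements_mat (D i) \<subseteq> polys V) \<and>
     (\<forall>c < n 0. homogeneous (a 0 c) (D 0 $$ (0, c))) \<and>
     (\<forall>i. \<forall>r < n i. \<forall>c < n (Suc i).
        homogeneous (a (Suc i) c - a i r) (D (Suc i) $$ (r, c))) \<and>
     I = (\<lambda>x. (D 0 *\<^sub>v x) $ 0) ` free_mod V (n 0) \<and>
     (\<forall>i. mat_kernel (D i) \<inter> free_mod V (n i) =
        (\<lambda>x. D (Suc i) *\<^sub>v x) ` free_mod V (n (Suc i)))"

text \<open>
  Minimality: the image of \<open>F\<^sub>i\<^sub>+\<^sub>1\<close> lies in \<open>\<mm> F\<^sub>i\<close>, where \<open>\<mm>\<close> is the irrelevant maximal ideal.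
\<close>

definition minimal_graded_free_resolution ::
  "'v set \<Rightarrow> ('v, 'k::field) mpol set \<Rightarrow>
   (nat \<Rightarrow> nat) \<Rightarrow> (nat \<Rightarrow> nat \<Rightarrow> int) \<Rightarrow> (nat \<Rightarrow> ('v, 'k) mpol mat) \<Rightarrow> bool" where
  "minimal_graded_free_resolution V I n a D \<longleftrightarrow>
     graded_free_resolution V I n a D \<and>
     (\<forall>i. elements_mat (D (Suc i)) \<subseteq> irrelevant_ideal V)"

text \<open>The number of basis elements of degree \<open>j\<close> in \<open>F\<^sub>i\<close>.\<close>

definition res_betti :: "(nat \<Rightarrow> nat) \<Rightarrow> (nat \<Rightarrow> nat \<Rightarrow> int) \<Rightarrow> nat \<Rightarrow> int \<Rightarrow> nat" where
  "res_betti n a i j = card {l. l < n i \<and> a i l = j}"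

text \<open>
  \<open>reg I = sup {j - i | \<beta>\<^sub>i\<^sub>,\<^sub>j(I) \<noteq> 0}\<close>, with the graded Betti numbers \<open>\<beta>\<^sub>i\<^sub>,\<^sub>j(I)\<close> read off from a minimal
  graded free resolution of the homogeneous ideal \<open>I\<close>, which exists (for finite \<open>V\<close>) and is unique
  up to isomorphism; the choice of the resolution is therefore immaterial and the supremum is
  taken over all of them.  The ideal is resolved as a module (the value for the quotient ring is
  smaller by one for a nonzero proper ideal), and the zero ideal has regularity \<open>-\<infinity>\<close>.
\<close>

definition regularity :: "'v set \<Rightarrow> ('v, 'k::field) mpol set \<Rightarrow> ereal" where
  "regularity V I =
     Sup {ereal (real_of_int (j - int i)) | i j.
            \<exists>n a D. minimal_graded_free_resolution V I n a D \<and> res_betti n a i j \<noteq> 0}"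

end

theory Submission
  imports Defs
begin

text \<open>
  A generator of degree \<open>j\<close> in \<open>F\<^sub>i\<close> gives a class of total degree \<open>j\<close> in the Koszul homology of the \<open>i\<close>-th
  syzygy module \<open>M\<^sub>i\<close> of the edge ideal \<open>I\<close>.  Since the Koszul complex of a free module is exact and the
  resolution is minimal, dimension shifting reduces the theorem to \<open>M\<^sub>0 = I\<close>: Koszul cycles with coefficients
  in \<open>I\<close> and of internal degree at least \<open>4\<close> are boundaries.  In a multidegree that is not squarefree the
  Koszul complex of \<open>I\<close> is a cone.  In the multidegree of a vertex set \<open>W\<close> it is the chain complex of
  \<open>{F \<subseteq> W. W - F contains an edge}\<close>, and one removes a vertex \<open>x\<close> having a neighbour \<open>z\<close> in \<open>W\<close>: the link is the
  complex of \<open>W - x\<close>, and the deletion is governed by the graph \<open>W - N[x]\<close>.  The latter is a split graph: its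
  vertices not adjacent to \<open>z\<close> are independent because \<open>G\<^sup>c\<close> has no induced 4-cycle, and those adjacent
  to \<open>z\<close> form a clique because \<open>G\<close> is claw free.
\<close>


section \<open>Chain complexes of simplicial complexes\<close>

locale vertex_indexing =
  fixes V :: "'v set" and idx :: "'v \<Rightarrow> nat"
  assumes finite_V: "finite V" and inj_idx: "inj_on idx V"
begin

section \<open>Signs and the Koszul differential\<close>

text \<open>The exterior algebra sign of \<open>v\<close> against \<open>F\<close>, for the order
  that \<open>idx\<close> induces on the vertices. Intersecting with \<open>V\<close> keeps the
  counted set finite for arbitrary \<open>F\<close>.\<close>

definition sg :: "'v \<Rightarrow> 'v set \<Rightarrow> 'a::comm_ring_1" where
  "sg v F = (-1) ^ card {u \<in> F \<inter> V. idx u < idx v}"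

lemma sg_sq [simp]: "sg v F * sg v F = 1"
  by (simp add: sg_def flip: power_add)

lemma sg_sq_left [simp]: "sg v F * (sg v F * a) = a"
  by (simp flip: mult.assoc)

lemma sg_self [simp]: "sg v (insert v F) = sg v F" "sg v (F - {v}) = sg v F"
  by (auto simp: sg_def intro!: arg_cong[where f = "\<lambda>A. (-1) ^ card A"])

lemma sg_insert:
  assumes "u \<in> V" "u \<notin> F"
  shows "sg v (insert u F) = (if idx u < idx v then - sg v F else sg v F)"
proof -
  have "{w \<in> insert u F \<inter> V. idx w < idx v} =
      (if idx u < idx v then insert u else id) {w \<in> F \<inter> V. idx w < idx v}"
    using assms by auto
  moreover have "finite {w \<in> F \<inter> V. idx w < idx v}"
    using finite_V by auto
  ultimately show ?thesis
    using assms by (auto simp: sg_def)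
qed

text \<open>Exactly one of \<open>u\<close> and \<open>v\<close> precedes the other, so exactly one
  of the two insertions flips a sign. This is the anticommutation of the basis elements belonging to
  \<open>u\<close> and \<open>v\<close>.\<close>

lemma sg_swap:
  assumes "u \<in> V" "v \<in> V" "u \<noteq> v" "u \<notin> F" "v \<notin> F"
  shows "sg v F * sg u (insert v F) = - (sg u F * sg v (insert u F))"
proof -
  have "idx u \<noteq> idx v"
    using assms inj_idx by (auto dest: inj_onD)
  then show ?thesis
    using assms by (auto simp: sg_insert mult.commute)
qed

text \<open>
  With \<open>w = var\<close> the Koszul differential on chains \<open>\<Sum>\<^sub>F f F e\<^sub>F\<close>, with \<open>w = 1\<close> the simplicial boundary.
\<close>

definition kos :: "('v \<Rightarrow> 'a::comm_ring_1) \<Rightarrow> ('v set \<Rightarrow> 'a) \<Rightarrow> 'v set \<Rightarrow> 'a" where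
  "kos w f F = (\<Sum>v\<in>V - F. sg v F * (w v * f (insert v F)))"

lemma kos_diff: "kos w (\<lambda>F. f F - g F) F = kos w f F - kos w g F"
  by (simp add: kos_def algebra_simps sum_subtractf)

lemma kos_add: "kos w (\<lambda>F. f F + g F) F = kos w f F + kos w g F"
  by (simp add: kos_def algebra_simps sum.distrib)

lemma kos_uminus: "kos w (\<lambda>F. - f F) F = - kos w f F"
  by (simp add: kos_def sum_negf)

text \<open>The double sum runs over ordered pairs of distinct vertices outside \<open>F\<close>.
  The pairs in \<open>P\<close> cancel against their mirror images in \<open>Q\<close> by
  \<open>sg_swap\<close>.\<close>

lemma kos_kos: "kos w (kos w f) F = 0"
proof -
  define h where "h v u = sg v F * sg u (insert v F) * (w v * w u * f (insert u (insert v F)))" for v u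
  define P where "P = {(v, u). v \<in> V - F \<and> u \<in> V - F \<and> idx v < idx u}"
  define Q where "Q = {(v, u). v \<in> V - F \<and> u \<in> V - F \<and> idx u < idx v}"
  have swap: "h v u = - h u v" if "(v, u) \<in> P" for u v
  proof -
    have "sg v F * sg u (insert v F) = - (sg u F * sg v (insert u F) :: 'a)"
      using that by (intro sg_swap) (auto simp: P_def)
    then show ?thesis
      by (simp add: h_def insert_commute[of u v] mult.commute[of "w v" "w u"])
  qed
  have "kos w (kos w f) F = (\<Sum>v\<in>V - F. \<Sum>u\<in>V - insert v F. h v u)"
    unfolding kos_def h_def by (simp add: sum_distrib_left mult_ac)
  also have "\<dots> = (\<Sum>(v, u)\<in>(SIGMA v:V - F. V - insert v F). h v u)"
    using finite_V by (subst sum.Sigma) auto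
  also have "(SIGMA v:V - F. V - insert v F) = P \<union> Q"
    using inj_on_eq_iff[OF inj_idx] by (auto simp: P_def Q_def not_less order.order_iff_strict)
  also have "(\<Sum>(v, u)\<in>P \<union> Q. h v u) = (\<Sum>(v, u)\<in>P. h v u) + (\<Sum>(v, u)\<in>Q. h v u)"
  proof (rule sum.union_disjoint)
    show "finite P" "finite Q"
      using finite_V by (auto simp: P_def Q_def intro: finite_subset[of _ "V \<times> V"])
  qed (auto simp: P_def Q_def)
  also have "(\<Sum>(v, u)\<in>Q. h v u) = (\<Sum>(v, u)\<in>P. h u v)"
    by (rule sum.reindex_bij_witness[of _ prod.swap prod.swap]) (auto simp: P_def Q_def)
  also have "(\<Sum>(v, u)\<in>P. h v u) + \<dots> = 0"
    unfolding sum.distrib[symmetric]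
  proof (intro sum.neutral ballI)
    fix p assume "p \<in> P"
    then show "(case p of (v, u) \<Rightarrow> h v u) + (case p of (v, u) \<Rightarrow> h u v) = 0"
      using swap[of "fst p" "snd p"] by (simp add: split_def)
  qed
  finally show ?thesis .
qed

abbreviation bd :: "('v set \<Rightarrow> 'a::comm_ring_1) \<Rightarrow> 'v set \<Rightarrow> 'a" where
  "bd \<equiv> kos (\<lambda>_. 1)"

text \<open>Contraction by the basis element of \<open>x\<close>: it extracts the part of a chain on
  sets containing \<open>x\<close> and views it, with sign, as a chain on the link of
  \<open>x\<close>.\<close>

definition contr :: "'v \<Rightarrow> ('v set \<Rightarrow> 'a::comm_ring_1) \<Rightarrow> 'v set \<Rightarrow> 'a" where
  "contr x f F = (if x \<in> F then 0 else sg x F * f (insert x F))"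

text \<open>The term for \<open>x\<close> itself drops out because \<open>contr x f\<close> vanishes
  on sets containing \<open>x\<close>. In every other term the two signs are exchanged by
  \<open>sg_swap\<close>.\<close>

lemma bd_contr:
  assumes "x \<in> V"
  shows "bd (contr x f) F = - contr x (bd f) F"
proof (cases "x \<in> F")
  case True
  then show ?thesis by (simp add: kos_def contr_def)
next
  case False
  have "bd (contr x f) F = (\<Sum>v\<in>V - insert x F. sg v F * contr x f (insert v F))"
    unfolding kos_def using finite_V by (auto intro!: sum.mono_neutral_right simp: contr_def)
  also have "\<dots> = (\<Sum>v\<in>V - insert x F. - (sg x F * (sg v (insert x F) * f (insert v (insert x F)))))"
  proof (rule sum.cong)
    fix v assume "v \<in> V - insert x F"
    then have "sg v F * sg x (insert v F) * f (insert v (insert x F))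
        = - (sg x F * sg v (insert x F)) * f (insert v (insert x F))"
      using assms False by (subst sg_swap) auto
    then show "sg v F * contr x f (insert v F)
        = - (sg x F * (sg v (insert x F) * f (insert v (insert x F))))"
      using \<open>v \<in> V - insert x F\<close> False by (auto simp: contr_def insert_commute mult.assoc)
  qed simp
  also have "\<dots> = - contr x (bd f) F"
    using False by (simp add: contr_def kos_def sum_distrib_left sum_negf)
  finally show ?thesis .
qed

section \<open>Acyclicity in low degrees: cones, and links with deletions\<close>

definition supported :: "('v set \<Rightarrow> 'a::comm_ring_1) \<Rightarrow> 'v set set \<Rightarrow> int \<Rightarrow> bool" where
  "supported f K r \<longleftrightarrow> (\<forall>F. f F \<noteq> 0 \<longrightarrow> F \<in> K \<and> int (card F) \<le> r)"

text \<open>For a simplicial complex on \<open>V\<close> this is the vanishing of reduced homology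
  on faces with at most \<open>r\<close> elements. A chain may mix faces of all sizes, the empty
  face included. The bound is an integer because it is later of the form \<open>card W - d\<close>
  and may be negative. The \<open>itself\<close> argument fixes the coefficient ring.\<close>

definition acyclic_upto :: "'a::comm_ring_1 itself \<Rightarrow> 'v set set \<Rightarrow> int \<Rightarrow> bool" where
  "acyclic_upto _ K r \<longleftrightarrow>
     (\<forall>f :: 'v set \<Rightarrow> 'a. supported f K r \<longrightarrow> (\<forall>F. bd f F = 0) \<longrightarrow>
        (\<exists>g. supported g K (r + 1) \<and> (\<forall>F. bd g F = f F)))"

lemma acyclic_upto_trivial:
  assumes "\<And>F. F \<in> K \<Longrightarrow> int (card F) > r"
  shows "acyclic_upto TYPE('a::comm_ring_1) K r"
  unfolding acyclic_upto_def
proof (intro allI impI)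
  fix f :: "'v set \<Rightarrow> 'a"
  assume "supported f K r"
  then have "f F = 0" for F
    using assms[of F] by (auto simp: supported_def)
  then show "\<exists>g. supported g K (r + 1) \<and> (\<forall>F. bd g F = f F)"
    by (intro exI[of _ "\<lambda>_. 0"]) (auto simp: supported_def kos_def)
qed

text \<open>Inserting the apex \<open>v\<close> into every face of \<open>f\<close> that avoids
  \<open>v\<close> is a contracting homotopy on cycles.\<close>

lemma acyclic_upto_cone:
  assumes v: "v \<in> V" and K: "\<And>F. F \<in> K \<Longrightarrow> F \<subseteq> V" and cone: "\<And>F. F \<in> K \<Longrightarrow> insert v F \<in> K"
  shows "acyclic_upto TYPE('a::comm_ring_1) K r"
  unfolding acyclic_upto_def
proof (intro allI impI)
  fix f :: "'v set \<Rightarrow> 'a"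
  assume f: "supported f K r" and cyc: "\<forall>F. bd f F = 0"
  define g where "g F = (if v \<in> F then sg v F * f (F - {v}) else 0)" for F
  have "supported g K (r + 1)"
    unfolding supported_def
  proof (intro allI impI)
    fix F assume "g F \<noteq> 0"
    then have "v \<in> F" "f (F - {v}) \<noteq> 0"
      by (auto simp: g_def split: if_splits)
    then have "F - {v} \<in> K" "int (card (F - {v})) \<le> r" "v \<in> F"
      using f by (auto simp: supported_def)
    moreover have "finite (F - {v})"
      using K[OF \<open>F - {v} \<in> K\<close>] finite_V finite_subset by blast
    ultimately show "F \<in> K \<and> int (card F) \<le> r + 1"
      using cone[of "F - {v}"] by (auto simp: insert_absorb card_Diff_singleton_if split: if_splits)
  qed
  moreover have "bd g F = f F" for F
  proof (cases "v \<in> F")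
    case False
    have "bd g F = (\<Sum>u\<in>{v}. sg u F * g (insert u F))"
      unfolding kos_def mult_1
      by (rule sum.mono_neutral_right) (use finite_V v False in \<open>auto simp: g_def\<close>)
    then show ?thesis
      using False by (simp add: g_def)
  next
    case True
    define F0 where "F0 = F - {v}"
    have F0: "v \<notin> F0" "F = insert v F0"
      using True by (auto simp: F0_def)
    \<comment> \<open>Contracting \<open>g\<close> by \<open>v\<close> returns the part of
      \<open>f\<close> that avoids \<open>v\<close>. Hence \<open>bd g F\<close> is, up to sign, the
      boundary of that part at \<open>F0\<close>, and the cycle condition for \<open>f\<close> at
      \<open>F0\<close> expresses it through \<open>f F\<close>.\<close>
    have *: "contr v g = (\<lambda>F. if v \<in> F then 0 else f F)"
      by (auto simp: contr_def g_def fun_eq_iff)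
    have "sg v F0 * bd g F = - bd (contr v g) F0"
      using F0 bd_contr[OF v, of g F0] by (simp add: contr_def)
    also have "bd (contr v g) F0 = (\<Sum>u\<in>V - F0 - {v}. sg u F0 * f (insert u F0))"
      unfolding kos_def * using finite_V F0 by (auto intro!: sum.mono_neutral_cong_right)
    also have "\<dots> = bd f F0 - sg v F0 * f F"
      unfolding kos_def using finite_V F0 v by (subst sum_diff1) auto
    finally have "sg v F0 * bd g F = sg v F0 * f F"
      using cyc by simp
    then show ?thesis
      by (metis sg_sq_left)
  qed
  ultimately show "\<exists>g. supported g K (r + 1) \<and> (\<forall>F. bd g F = f F)"
    by blast
qed

text \<open>The long exact sequence of link and deletion, written out on chains. The contraction of
  the cycle \<open>f\<close> by \<open>x\<close> is a cycle of the link, with one vertex less, and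
  bounds some \<open>g1\<close>. Coning \<open>g1\<close> with \<open>x\<close> gives
  \<open>g2\<close> such that \<open>f - bd g2\<close> avoids \<open>x\<close>, and this cycle
  bounds in the deletion.\<close>

lemma acyclic_upto_link_del:
  assumes x: "x \<in> V" and K: "\<And>F. F \<in> K \<Longrightarrow> F \<subseteq> V"
    and down: "\<And>F u. insert u F \<in> K \<Longrightarrow> F \<in> K"
    and link: "acyclic_upto TYPE('a::comm_ring_1) {F. x \<notin> F \<and> insert x F \<in> K} (r - 1)"
    and del: "acyclic_upto TYPE('a) {F \<in> K. x \<notin> F} r"
  shows "acyclic_upto TYPE('a) K r"
  unfolding acyclic_upto_def
proof (intro allI impI)
  fix f :: "'v set \<Rightarrow> 'a"
  assume f: "supported f K r" and cyc: "\<forall>F. bd f F = 0"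
  have fin: "finite F" if "F \<in> K" for F
    using K[OF that] finite_V finite_subset by blast
  have "supported (contr x f) {F. x \<notin> F \<and> insert x F \<in> K} (r - 1)"
    unfolding supported_def
  proof (intro allI impI)
    fix F assume "contr x f F \<noteq> 0"
    then have *: "x \<notin> F" "f (insert x F) \<noteq> 0"
      by (auto simp: contr_def split: if_splits)
    then have "insert x F \<in> K" "int (card (insert x F)) \<le> r"
      using f by (auto simp: supported_def)
    then show "F \<in> {F. x \<notin> F \<and> insert x F \<in> K} \<and> int (card F) \<le> r - 1"
      using * fin[of "insert x F"] by auto
  qed
  moreover have "\<forall>F. bd (contr x f) F = 0"
    using cyc by (simp add: bd_contr[OF x]) (simp add: contr_def)
  ultimately obtain g1 where
      g1: "supported g1 {F. x \<notin> F \<and> insert x F \<in> K} r" "\<And>F. bd g1 F = contr x f F"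
    using link unfolding acyclic_upto_def by fastforce
  \<comment> \<open>The minus sign compensates the one in \<open>bd_contr\<close>, so that
    \<open>bd g2\<close> and \<open>f\<close> agree on sets containing \<open>x\<close>.\<close>
  define g2 where "g2 F = (if x \<in> F then - sg x F * g1 (F - {x}) else 0)" for F
  have g2: "supported g2 K (r + 1)"
    unfolding supported_def
  proof (intro allI impI)
    fix F assume "g2 F \<noteq> 0"
    then have *: "x \<in> F" "g1 (F - {x}) \<noteq> 0"
      by (auto simp: g2_def split: if_splits)
    then have "insert x (F - {x}) \<in> K" "int (card (F - {x})) \<le> r"
      using g1(1) unfolding supported_def by blast+
    then show "F \<in> K \<and> int (card F) \<le> r + 1"
      using * fin[of F] by (auto simp: insert_absorb card_Diff_singleton_if split: if_splits)
  qed
  have "contr x g2 F = - g1 F" for F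
    using g1(1) by (auto simp: contr_def g2_def supported_def)
  then have contr_g2: "contr x g2 = (\<lambda>F. - g1 F)"
    by auto
  define f' where "f' F = f F - bd g2 F" for F
  have f'_x: "f' F = 0" if "x \<in> F" for F
  proof -
    have "contr x (bd g2) (F - {x}) = contr x f (F - {x})"
      using bd_contr[OF x, of g2 "F - {x}"] g1(2) by (simp add: contr_g2 kos_uminus)
    then have "sg x F * bd g2 F = sg x F * f F"
      using that by (simp add: contr_def insert_absorb)
    then show ?thesis
      unfolding f'_def by (metis eq_iff_diff_eq_0 sg_sq_left)
  qed
  have "supported f' {F \<in> K. x \<notin> F} r"
    unfolding supported_def
  proof (intro allI impI)
    fix F assume F: "f' F \<noteq> 0"
    have "F \<in> K \<and> int (card F) \<le> r"
    proof (cases "f F = 0")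
      case False
      then show ?thesis using f by (auto simp: supported_def)
    next
      case True
      then have "bd g2 F \<noteq> 0"
        using F by (auto simp: f'_def)
      \<comment> \<open>\<open>F\<close> arises from a face of \<open>g2\<close> by removing one
        vertex. Therefore \<open>down\<close> puts \<open>F\<close> into \<open>K\<close>, and the
        size bound drops from \<open>r + 1\<close> to \<open>r\<close>.\<close>
      then obtain u where u: "u \<in> V - F" "g2 (insert u F) \<noteq> 0"
        unfolding kos_def by (metis (no_types, lifting) mult_zero_right sum.neutral)
      then have *: "insert u F \<in> K" "int (card (insert u F)) \<le> r + 1"
        using g2 by (auto simp: supported_def)
      then show ?thesis
        using down[OF *(1)] u fin[OF *(1)] by auto
    qed
    then show "F \<in> {F \<in> K. x \<notin> F} \<and> int (card F) \<le> r"
      using F f'_x by auto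
  qed
  moreover have "\<forall>F. bd f' F = 0"
    using cyc by (simp add: f'_def[abs_def] kos_diff kos_kos)
  ultimately obtain g3 where g3: "supported g3 {F \<in> K. x \<notin> F} (r + 1)" "\<And>F. bd g3 F = f' F"
    using del unfolding acyclic_upto_def by blast
  have "supported (\<lambda>F. g2 F + g3 F) K (r + 1)"
    using g2 g3(1) unfolding supported_def by (metis (no_types, lifting) add_0 mem_Collect_eq)
  moreover have "bd (\<lambda>F. g2 F + g3 F) F = f F" for F
    by (simp add: kos_add g3(2) f'_def)
  ultimately show "\<exists>g. supported g K (r + 1) \<and> (\<forall>F. bd g F = f F)"
    by blast
qed

end


section \<open>Gap-free and claw-free graphs\<close>

lemma simple_graph_edgeE:
  assumes "simple_graph V E" "e \<in> E"
  obtains x y where "e = {x, y}" "x \<noteq> y" "x \<in> V" "y \<in> V"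
  using assms unfolding simple_graph_def by (force simp: card_2_iff)

text \<open>If no edge joins the two disjoint edges, then \<open>a, c, b, d\<close> in this cyclic
  order is an induced 4-cycle of the complement, with the two given edges as its missing
  diagonals.\<close>

lemma gap_freeD:
  assumes G: "simple_graph V E" and gap: "\<not> has_induced_4_cycle V (complement_edges V E)"
    and e: "{a, b} \<in> E" "{c, d} \<in> E" and dist: "{a, b} \<inter> {c, d} = {}"
  shows "{a, c} \<in> E \<or> {a, d} \<in> E \<or> {b, c} \<in> E \<or> {b, d} \<in> E"
proof (rule ccontr)
  assume *: "\<not> ?thesis"
  have V: "a \<in> V" "b \<in> V" "c \<in> V" "d \<in> V" and ne: "a \<noteq> b" "c \<noteq> d"
    using e G by (auto simp: simple_graph_def card_2_iff doubleton_eq_iff)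
  have ne': "a \<noteq> c" "a \<noteq> d" "b \<noteq> c" "b \<noteq> d"
    using dist by auto
  have "induced_edges (complement_edges V E) {a, c, b, d} = {{a, c}, {c, b}, {b, d}, {d, a}}"
    (is "?L = ?R")
  proof (intro subset_antisym subsetI)
    fix s assume "s \<in> ?L"
    then obtain u v where s: "s = {u, v}" "u \<noteq> v"
        and uv: "u \<in> {a, c, b, d}" "v \<in> {a, c, b, d}" "{u, v} \<notin> E"
      by (auto simp: induced_edges_def complement_edges_def card_2_iff)
    have "{b, a} \<in> E" "{d, c} \<in> E"
      using e by (simp_all only: insert_commute[of b a] insert_commute[of d c])
    then show "s \<in> ?R"
      using e s(2) uv unfolding s(1) by (auto simp: doubleton_eq_iff)
  next
    fix s assume "s \<in> ?R"
    moreover have "{c, b} \<notin> E" "{d, a} \<notin> E"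
      using * by (simp_all only: insert_commute[of c b] insert_commute[of d a]) simp_all
    ultimately show "s \<in> ?L"
      using * V ne ne' by (auto simp: induced_edges_def complement_edges_def)
  qed
  moreover have "card {a, c, b, d} = 4" "{a, c, b, d} \<subseteq> V"
    using V ne ne' by auto
  ultimately have "has_induced_4_cycle V (complement_edges V E)"
    unfolding has_induced_4_cycle_def
    by (intro exI[of _ a] exI[of _ c] exI[of _ b] exI[of _ d] conjI)
  then show False
    using gap by contradiction
qed

lemma claw_freeD:
  assumes G: "simple_graph V E" and claw: "claw_free V E"
    and e: "{c, x} \<in> E" "{c, y} \<in> E" "{c, z} \<in> E" and dist: "x \<noteq> y" "x \<noteq> z" "y \<noteq> z"
  shows "{x, y} \<in> E \<or> {x, z} \<in> E \<or> {y, z} \<in> E"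
proof (rule ccontr)
  assume *: "\<not> ?thesis"
  have V: "c \<in> V" "x \<in> V" "y \<in> V" "z \<in> V" and ne: "c \<noteq> x" "c \<noteq> y" "c \<noteq> z"
    using e G by (auto simp: simple_graph_def card_2_iff doubleton_eq_iff)
  have "induced_edges E {c, x, y, z} = {{c, w} | w. w \<in> {c, x, y, z} - {c}}" (is "?L = ?R")
  proof (intro subset_antisym subsetI)
    fix s assume "s \<in> ?L"
    then have "s \<in> E" "s \<subseteq> {c, x, y, z}"
      by (auto simp: induced_edges_def)
    then obtain u v where s: "s = {u, v}" "u \<noteq> v"
        and uv: "u \<in> {c, x, y, z}" "v \<in> {c, x, y, z}" "{u, v} \<in> E"
      using simple_graph_edgeE[OF G] by (metis insert_subset)
    have "{y, x} \<notin> E" "{z, x} \<notin> E" "{z, y} \<notin> E"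
      using * by (simp_all only: insert_commute[of y x] insert_commute[of z x] insert_commute[of z y])
        simp_all
    then show "s \<in> ?R"
      using * s(2) uv unfolding s(1) by (auto simp: doubleton_eq_iff)
  next
    fix s assume "s \<in> ?R"
    then show "s \<in> ?L"
      using e by (auto simp: induced_edges_def)
  qed
  moreover have "card {c, x, y, z} = 4" "{c, x, y, z} \<subseteq> V"
    using V ne dist by auto
  ultimately have "\<exists>W\<subseteq>V. card W = 4 \<and> (\<exists>c\<in>W. induced_edges E W = {{c, w} | w. w \<in> W - {c}})"
    by (intro exI[of _ "{c, x, y, z}"] bexI[of _ c] conjI) simp_all
  then show False
    using claw unfolding claw_free_def by contradiction
qed

text \<open>
  The Koszul complex, in multidegree \<open>W\<close>, of the ideal generated by the edges and the variables in \<open>N\<close>.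
\<close>

definition edge_complex :: "'v set set \<Rightarrow> 'v set \<Rightarrow> 'v set \<Rightarrow> 'v set set" where
  "edge_complex E W N = {F. F \<subseteq> W \<and> ((\<exists>e\<in>E. e \<subseteq> W - F) \<or> N \<inter> (W - F) \<noteq> {})}"

lemma edge_complex_down: "insert u F \<in> edge_complex E W N \<Longrightarrow> F \<in> edge_complex E W N"
proof -
  assume *: "insert u F \<in> edge_complex E W N"
  have "W - insert u F \<subseteq> W - F"
    by auto
  with * show ?thesis
    unfolding edge_complex_def by (simp, meson order_trans disjoint_iff subsetD)
qed

text \<open>Moving \<open>x\<close> from the face to the removed vertices leaves the complement of
  the face in \<open>W\<close> unchanged. This lets inductions on \<open>W\<close> stay within the
  same family of complexes.\<close>

lemma edge_complex_link:
  "x \<in> W \<Longrightarrow> {F. x \<notin> F \<and> insert x F \<in> edge_complex E W N} = edge_complex E (W - {x}) N"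
proof -
  assume "x \<in> W"
  have "x \<notin> F \<and> insert x F \<subseteq> W \<longleftrightarrow> F \<subseteq> W - {x}" for F
    using \<open>x \<in> W\<close> by auto
  moreover have "W - {x} - F = W - insert x F" for F
    by auto
  ultimately show ?thesis
    unfolding edge_complex_def by (simp only: mem_Collect_eq conj_assoc[symmetric])
qed

section \<open>Acyclicity of the complexes of edges\<close>

context vertex_indexing
begin

text \<open>Induction on the number of vertices of \<open>W\<close> in \<open>N\<close>. For such a
  vertex \<open>y\<close>, a set avoiding \<open>y\<close> always leaves \<open>y\<close> in its
  complement, so the deletion of \<open>y\<close> is the full simplex on \<open>W - {y}\<close>. The
  link is the complex of \<open>W - {y}\<close>, and the bound drops by one together with
  \<open>card W\<close>.\<close>

lemma acyclic_upto_strip_variables: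
  assumes "W \<subseteq> V" and d: "d \<ge> 2"
    and "acyclic_upto TYPE('a::comm_ring_1) (edge_complex E (W - N) {}) (int (card (W - N)) - d)"
  shows "acyclic_upto TYPE('a) (edge_complex E W N) (int (card W) - d)"
  using assms(1,3)
proof (induction "card (W \<inter> N)" arbitrary: W)
  case 0
  then have "W \<inter> N = {}"
    using finite_V finite_subset by fastforce
  then have "W - N = W" "edge_complex E W N = edge_complex E W {}"
    by (auto simp: edge_complex_def)
  then show ?case
    using 0 by simp
next
  case (Suc n)
  then obtain y where y: "y \<in> W" "y \<in> N"
    by (metis IntE card.empty ex_in_conv old.nat.distinct(2))
  have fin: "finite W"
    using Suc.prems finite_V finite_subset by blast
  have W': "W - {y} - N = W - N" "(W - {y}) \<inter> N = W \<inter> N - {y}"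
    using y by auto
  have card: "int (card (W - {y})) = int (card W) - 1"
    using card_Suc_Diff1[OF fin y(1)] by linarith
  show ?case
  proof (rule acyclic_upto_link_del[of y])
    show "y \<in> V"
      using y Suc.prems by auto
    show "F \<subseteq> V" if "F \<in> edge_complex E W N" for F
      using that Suc.prems by (auto simp: edge_complex_def)
    show "F \<in> edge_complex E W N" if "insert u F \<in> edge_complex E W N" for F u
      using that by (rule edge_complex_down)
    have "acyclic_upto TYPE('a) (edge_complex E (W - {y}) N) (int (card (W - {y})) - d)"
      using Suc y fin by (intro Suc.hyps) (auto simp: W')
    moreover have "int (card (W - {y})) - d = int (card W) - d - 1"
      using card by simp
    ultimately show "acyclic_upto TYPE('a) {F. y \<notin> F \<and> insert y F \<in> edge_complex E W N}
        (int (card W) - d - 1)"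
      by (simp only: edge_complex_link[OF y(1)])
    have del: "{F \<in> edge_complex E W N. y \<notin> F} = Pow (W - {y})"
      using y by (auto simp: edge_complex_def)
    show "acyclic_upto TYPE('a) {F \<in> edge_complex E W N. y \<notin> F} (int (card W) - d)"
    \<comment> \<open>The simplex on no vertices consists of the empty face only and is not a cone.
      There \<open>d \<ge> 2\<close> makes the bound \<open>1 - d\<close> negative, and nothing has
      to be shown.\<close>
    proof (cases "W = {y}")
      case True
      then show ?thesis
        using d by (intro acyclic_upto_trivial) auto
    next
      case False
      then obtain v where "v \<in> W - {y}"
        using y by auto
      then show ?thesis
        unfolding del using Suc.prems by (intro acyclic_upto_cone[of v]) auto
    qed
  qed
qed

text \<open>The combinatorial form of reg I \<le> max (reg (I : x) + 1) (reg (I, x)). An edge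
  missing \<open>F\<close> either avoids \<open>x\<close> or supplies a neighbour of
  \<open>x\<close> outside \<open>F\<close>. So the deletion of \<open>x\<close> is the complex of
  \<open>W - {x}\<close> in which the neighbours of \<open>x\<close> count as variables, and
  stripping these leaves the non-neighbours. The offset \<open>d\<close> becomes
  \<open>d + 1\<close> since \<open>W - {x}\<close> has one vertex less than
  \<open>W\<close>.\<close>

lemma acyclic_upto_vertex_removal:
  assumes E: "\<And>e. e \<in> E \<Longrightarrow> card e = 2" and W: "W \<subseteq> V" and d: "d \<ge> 2" and x: "x \<in> W"
    and minus: "acyclic_upto TYPE('a::comm_ring_1) (edge_complex E (W - {x}) {})
      (int (card (W - {x})) - (d + 1))"
    and nbhd: "acyclic_upto TYPE('a) (edge_complex E (W - {x} - {y. {x, y} \<in> E}) {})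
      (int (card (W - {x} - {y. {x, y} \<in> E})) - d)"
  shows "acyclic_upto TYPE('a) (edge_complex E W {}) (int (card W) - (d + 1))"
proof (rule acyclic_upto_link_del[of x])
  have fin: "finite W"
    using W finite_V finite_subset by blast
  have card: "int (card (W - {x})) = int (card W) - 1"
    using card_Suc_Diff1[OF fin x] by linarith
  show "x \<in> V"
    using x W by auto
  show "F \<subseteq> V" if "F \<in> edge_complex E W {}" for F
    using that W by (auto simp: edge_complex_def)
  show "F \<in> edge_complex E W {}" if "insert u F \<in> edge_complex E W {}" for F u
    using that by (rule edge_complex_down)
  have "int (card (W - {x})) - (d + 1) = int (card W) - (d + 1) - 1"
    using card by simp
  then show "acyclic_upto TYPE('a) {F. x \<notin> F \<and> insert x F \<in> edge_complex E W {}}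
      (int (card W) - (d + 1) - 1)"
    using minus by (simp only: edge_complex_link[OF x])
  have nbhd_iff: "(\<exists>e\<in>E. e \<subseteq> W - F) \<longleftrightarrow>
      (\<exists>e\<in>E. e \<subseteq> W - {x} - F) \<or> {y. {x, y} \<in> E} \<inter> (W - {x} - F) \<noteq> {}" (is "?l \<longleftrightarrow> ?r")
    if F: "x \<notin> F" for F
  proof
    assume ?l
    then obtain e where e: "e \<in> E" "e \<subseteq> W - F" by auto
    show ?r
    proof (cases "x \<in> e")
      case False
      then show ?thesis using e by auto
    next
      case True
      then obtain y where "e = {x, y}" "y \<noteq> x"
        using E[OF e(1)] by (auto simp: card_2_iff doubleton_eq_iff)
      then show ?thesis using e by auto
    qed
  next
    assume ?r
    then show ?l
    proof
      assume "\<exists>e\<in>E. e \<subseteq> W - {x} - F"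
      then show ?l by blast
    next
      assume "{y. {x, y} \<in> E} \<inter> (W - {x} - F) \<noteq> {}"
      then obtain y where "{x, y} \<in> E" "{x, y} \<subseteq> W - F"
        using F x by auto
      then show ?l by blast
    qed
  qed
  have "F \<in> {F \<in> edge_complex E W {}. x \<notin> F} \<longleftrightarrow> F \<in> edge_complex E (W - {x}) {y. {x, y} \<in> E}" for F
  proof (cases "x \<in> F")
    case True
    then show ?thesis by (auto simp: edge_complex_def)
  next
    case False
    then have "F \<subseteq> W - {x} \<longleftrightarrow> F \<subseteq> W" by auto
    then show ?thesis
      by (simp only: edge_complex_def mem_Collect_eq nbhd_iff[OF False] False Int_empty_left simp_thms)
  qed
  then have "{F \<in> edge_complex E W {}. x \<notin> F} = edge_complex E (W - {x}) {y. {x, y} \<in> E}"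
    by (rule Set.set_eqI)
  moreover have "acyclic_upto TYPE('a) (edge_complex E (W - {x}) {y. {x, y} \<in> E})
      (int (card (W - {x})) - d)"
    by (rule acyclic_upto_strip_variables[OF _ d nbhd]) (use W in auto)
  moreover have "int (card (W - {x})) - d = int (card W) - (d + 1)"
    using card by simp
  ultimately show "acyclic_upto TYPE('a) {F \<in> edge_complex E W {}. x \<notin> F} (int (card W) - (d + 1))"
    by (simp only:)
qed

lemma acyclic_upto_independent:
  assumes "\<And>e. e \<in> E \<Longrightarrow> \<not> e \<subseteq> W"
  shows "acyclic_upto TYPE('a::comm_ring_1) (edge_complex E W {}) r"
  using assms by (intro acyclic_upto_trivial) (auto simp: edge_complex_def)

text \<open>The offset 3 encodes regularity at most 2, that is, a linear resolution. The clique
  \<open>B\<close> is built up one vertex at a time, starting from the independent set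
  \<open>A\<close>, whose complex is empty.\<close>

lemma acyclic_upto_split_graph:
  assumes E: "\<And>e. e \<in> E \<Longrightarrow> card e = 2" and V: "A \<union> B \<subseteq> V"
    and A: "\<And>e. e \<in> E \<Longrightarrow> \<not> e \<subseteq> A"
    and B: "\<And>u v. u \<in> B \<Longrightarrow> v \<in> B \<Longrightarrow> u \<noteq> v \<Longrightarrow> {u, v} \<in> E"
  shows "acyclic_upto TYPE('a::comm_ring_1) (edge_complex E (A \<union> B) {}) (int (card (A \<union> B)) - 3)"
proof -
  have "finite B"
    using V finite_V finite_subset by blast
  then show ?thesis
    using V B
  proof (induction B rule: finite_induct)
    case empty
    then show ?case
      using A by (auto intro: acyclic_upto_independent)
  next
    case (insert b B)
    have IH: "acyclic_upto TYPE('a) (edge_complex E (A \<union> B) {}) (int (card (A \<union> B)) - 3)"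
      using insert by auto
    show ?case
    proof (cases "b \<in> A \<union> B")
      case True
      then have "A \<union> insert b B = A \<union> B" by auto
      then show ?thesis using IH by simp
    next
      case False
      let ?W = "A \<union> insert b B"
      have "?W - {b} = A \<union> B"
        using False by auto
      \<comment> \<open>Every other vertex of the clique is a neighbour of \<open>b\<close>, so only
        vertices of \<open>A\<close> survive. They span no edge, and the resulting complex is
        acyclic in every range.\<close>
      moreover have "?W - {b} - {y. {b, y} \<in> E} \<subseteq> A"
        using insert.prems insert.hyps by auto
      then have "acyclic_upto TYPE('a) (edge_complex E (?W - {b} - {y. {b, y} \<in> E}) {}) r" for r
        using A by (intro acyclic_upto_independent) blast
      ultimately show ?thesis
        using acyclic_upto_vertex_removal[of E ?W 2 b, where 'a = 'a] E insert.prems(1) IH by simp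
    qed
  qed
qed

text \<open>Induction on \<open>W\<close>, removing an endpoint \<open>x\<close> of an edge. The
  vertices outside the closed neighbourhood of \<open>x\<close> form a split graph with offset 3,
  and the one removal raises it to 4.\<close>

lemma acyclic_upto_gap_free_claw_free:
  assumes G: "simple_graph V E" and claw: "claw_free V E"
    and gap: "\<not> has_induced_4_cycle V (complement_edges V E)" and "W \<subseteq> V"
  shows "acyclic_upto TYPE('a::comm_ring_1) (edge_complex E W {}) (int (card W) - 4)"
proof -
  have E: "card e = 2" if "e \<in> E" for e
    using G that by (auto simp: simple_graph_def)
  have "finite W"
    using \<open>W \<subseteq> V\<close> finite_V finite_subset by blast
  then show ?thesis
    using \<open>W \<subseteq> V\<close>
  proof (induction W rule: finite_psubset_induct)
    case (psubset W)
    show ?case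
    proof (cases "\<exists>e\<in>E. e \<subseteq> W")
      case False
      then show ?thesis by (intro acyclic_upto_independent) auto
    next
      case True
      then obtain x z where xz: "{x, z} \<in> E" "x \<in> W" "z \<in> W" "x \<noteq> z"
        using simple_graph_edgeE[OF G] by (metis insert_subset)
      let ?W = "W - {x} - {y. {x, y} \<in> E}"
      define A where "A = {w \<in> ?W. {z, w} \<notin> E}"
      define B where "B = {w \<in> ?W. {z, w} \<in> E}"
      \<comment> \<open>An edge inside \<open>A\<close> is disjoint from the edge
        \<open>{x, z}\<close>, and neither of its ends is adjacent to \<open>x\<close> or to
        \<open>z\<close>, against \<open>gap_freeD\<close>.\<close>
      have A: "\<not> e \<subseteq> A" if "e \<in> E" for e
      proof
        assume "e \<subseteq> A"
        obtain u v where uv: "e = {u, v}" "u \<noteq> v"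
          using simple_graph_edgeE[OF G \<open>e \<in> E\<close>] .
        have "{x, z} \<inter> {u, v} = {}"
          using \<open>e \<subseteq> A\<close> uv xz(1) by (auto simp: A_def)
        then show False
          using gap_freeD[OF G gap xz(1), of u v] \<open>e \<in> E\<close> \<open>e \<subseteq> A\<close> uv by (auto simp: A_def)
      qed
      \<comment> \<open>Here \<open>z\<close> is adjacent to \<open>x\<close>, \<open>u\<close> and
        \<open>v\<close>, while \<open>x\<close> is adjacent to neither \<open>u\<close> nor
        \<open>v\<close>. Claw freeness leaves only the edge \<open>{u, v}\<close>.\<close>
      have B: "{u, v} \<in> E" if "u \<in> B" "v \<in> B" "u \<noteq> v" for u v
        using claw_freeD[OF G claw, of z x u v] that xz(1) by (auto simp: B_def insert_commute[of z x])
      have AB: "A \<union> B = ?W"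
        by (auto simp: A_def B_def)
      have "A \<union> B \<subseteq> V"
        using psubset.prems unfolding AB by blast
      then have "acyclic_upto TYPE('a) (edge_complex E ?W {}) (int (card ?W) - 3)"
        unfolding AB[symmetric] using E A B by (intro acyclic_upto_split_graph)
      moreover have "acyclic_upto TYPE('a) (edge_complex E (W - {x}) {}) (int (card (W - {x})) - 4)"
        using psubset xz by blast
      ultimately show ?thesis
        using acyclic_upto_vertex_removal[of E W 3 x, where 'a = 'a, simplified numeral_plus_one]
          E psubset.prems xz by simp
    qed
  qed
qed

end


section \<open>The multigraded Koszul complex\<close>

abbreviation (input) "keys \<equiv> Poly_Mapping.keys"
abbreviation (input) "lookup \<equiv> Poly_Mapping.lookup"

lemma keys_add_nat: "keys (a + b) = keys a \<union> keys (b :: 'v \<Rightarrow>\<^sub>0 nat)"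
  by (auto simp: in_keys_iff lookup_add)

lemma monom_deg_eq_sum: "finite A \<Longrightarrow> keys m \<subseteq> A \<Longrightarrow> monom_deg m = (\<Sum>v\<in>A. lookup m v)"
  unfolding monom_deg_def by (rule sum.mono_neutral_left) (auto simp: in_keys_iff)

lemma monom_deg_add: "monom_deg (a + b) = monom_deg a + monom_deg b"
proof -
  have "monom_deg m = (\<Sum>v\<in>keys a \<union> keys b. lookup m v)" if "keys m \<subseteq> keys a \<union> keys b" for m
    using that by (intro monom_deg_eq_sum) auto
  then show ?thesis
    by (simp add: keys_add_nat lookup_add sum.distrib)
qed

lemma lookup_var_mult:
  "lookup (var v * p) m = (if v \<in> keys m then lookup p (m - Poly_Mapping.single v 1) else 0)"
proof -
  have "lookup (var v * p) m = (\<Sum>q. lookup p q when m = Poly_Mapping.single v 1 + q)"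
    by (simp add: lookup_mult var_def lookup_single when_mult)
  also have "\<dots> = (if v \<in> keys m then lookup p (m - Poly_Mapping.single v 1) else 0)"
  proof (cases "v \<in> keys m")
    case True
    then have "m = Poly_Mapping.single v 1 + q \<longleftrightarrow> q = m - Poly_Mapping.single v 1" for q
      by (auto simp: poly_mapping_eq_iff fun_eq_iff lookup_add lookup_minus lookup_single when_def in_keys_iff)
    then show ?thesis
      using True by simp
  next
    case False
    then have "m \<noteq> Poly_Mapping.single v 1 + q" for q
      by (auto simp: keys_add_nat)
    then show ?thesis
      using False by simp
  qed
  finally show ?thesis .
qed

lemma mpol_sum_monomials: "p = (\<Sum>m\<in>keys p. Poly_Mapping.single m (lookup p m))"
proof (rule poly_mapping_eqI)
  fix m
  have "(\<Sum>n\<in>keys p. lookup p n when n = m) = (\<Sum>n\<in>keys p. if n = m then lookup p n else 0)"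
    by (simp add: when_def)
  then show "lookup p m = lookup (\<Sum>n\<in>keys p. Poly_Mapping.single n (lookup p n)) m"
    by (simp add: lookup_sum lookup_single in_keys_iff)
qed

lemma var_in_polys: "v \<in> V \<Longrightarrow> var v \<in> polys V"
  by (simp add: var_def polys_def)

lemma poly_ring_simps:
  "carrier (poly_ring V) = polys V" "p \<otimes>\<^bsub>poly_ring V\<^esub> q = p * q" "p \<oplus>\<^bsub>poly_ring V\<^esub> q = p + q"
  "\<zero>\<^bsub>poly_ring V\<^esub> = 0" "\<one>\<^bsub>poly_ring V\<^esub> = 1"
  by (simp_all add: poly_ring_def)

text \<open>The condition \<open>up\<close> makes \<open>Q\<close> stable under multiplication by
  monomials, and every monomial of a product is a product of monomials of the factors. Instances of
  this bound the irrelevant ideal and the edge ideal from above.\<close>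

lemma ideal_monomials:
  assumes up: "\<And>a b. Q a \<Longrightarrow> Q (a + b)"
  shows "ideal {p \<in> polys V. \<forall>m\<in>keys p. Q m} (poly_ring V)" (is "ideal ?J _")
proof -
  interpret cring "poly_ring V :: ('a, 'b) mpol ring"
    by (rule cring_poly_ring)
  have minus: "\<ominus>\<^bsub>poly_ring V\<^esub> p = - p" if "p \<in> polys V" for p :: "('a, 'b) mpol"
    using that by (intro minus_equality) (auto simp: poly_ring_def polys_closed)
  have mult: "q * p \<in> ?J" "p * q \<in> ?J" if p: "p \<in> ?J" and q: "q \<in> polys V" for p q :: "('a, 'b) mpol"
  proof -
    have "Q m" if "m \<in> keys (p * q)" for m
      using p keys_mult[of p q] that up by fastforce
    then show "p * q \<in> ?J" "q * p \<in> ?J"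
      using p q by (auto simp: polys_closed mult.commute[of q p])
  qed
  show ?thesis
  proof (rule idealI)
    show "subgroup ?J (add_monoid (poly_ring V))"
    proof (rule group.subgroupI[OF a_group])
      show "?J \<subseteq> carrier (add_monoid (poly_ring V))"
        by (auto simp: poly_ring_def)
      show "?J \<noteq> {}"
        using polys_closed(1) by force
      show "inv\<^bsub>add_monoid (poly_ring V)\<^esub> p \<in> ?J" if "p \<in> ?J" for p
        using that minus[of p] polys_closed(4)[of p] by (auto simp: a_inv_def in_keys_iff)
      show "p \<otimes>\<^bsub>add_monoid (poly_ring V)\<^esub> q \<in> ?J" if "p \<in> ?J" "q \<in> ?J" for p q
        using that keys_add[of p q] by (auto simp: poly_ring_def polys_closed)
    qed
    show "q \<otimes>\<^bsub>poly_ring V\<^esub> p \<in> ?J" "p \<otimes>\<^bsub>poly_ring V\<^esub> q \<in> ?J"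
      if "p \<in> ?J" "q \<in> carrier (poly_ring V)" for p q
      using that mult[of p q] by (simp_all only: poly_ring_simps)
  qed (rule ring_axioms)
qed

text \<open>The polynomials without constant term form an ideal containing all variables. Minimality
  of a resolution enters the argument only in this form.\<close>

lemma irrelevant_ideal_const:
  fixes p :: "('a, 'b::field) mpol"
  assumes p: "p \<in> irrelevant_ideal V"
  shows "lookup p 0 = 0"
proof -
  interpret cring "poly_ring V :: ('a, 'b) mpol ring"
    by (rule cring_poly_ring)
  have "ideal {p \<in> polys V. \<forall>m\<in>keys p. m \<noteq> 0} (poly_ring V :: ('a, 'b) mpol ring)"
    by (rule ideal_monomials) (auto simp: poly_mapping_eq_iff fun_eq_iff lookup_add)
  moreover have "var ` V \<subseteq> {p \<in> polys V. \<forall>m\<in>keys p. m \<noteq> 0}"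
    by (auto simp: var_in_polys) (auto simp: var_def dest!: arg_cong[where f = keys])
  ultimately have "(irrelevant_ideal V :: ('a, 'b) mpol set) \<subseteq> {p \<in> polys V. \<forall>m\<in>keys p. m \<noteq> 0}"
    unfolding irrelevant_ideal_def by (rule genideal_minimal)
  then have "0 \<notin> keys p"
    using p by blast
  then show ?thesis
    by (simp add: in_keys_iff)
qed

text \<open>The right-hand side is a monomial ideal containing the generators. Conversely, each term
  of such a polynomial is a multiple of some product of the two variables of an edge, and the
  polynomial is the sum of its terms.\<close>

lemma edge_ideal_eq:
  assumes G: "simple_graph V E"
  shows "(edge_ideal V E :: ('a, 'b::field) mpol set) = {p \<in> polys V. \<forall>m\<in>keys p. \<exists>e\<in>E. e \<subseteq> keys m}" (is "_ = ?J")
proof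
  interpret cring "poly_ring V :: ('a, 'b) mpol ring"
    by (rule cring_poly_ring)
  let ?S = "{var i * var j | i j. {i, j} \<in> E} :: ('a, 'b) mpol set"
  have V: "i \<in> V" "j \<in> V" "i \<noteq> j" if "{i, j} \<in> E" for i j
    using G that by (auto simp: simple_graph_def card_2_iff doubleton_eq_iff)
  have S: "?S \<subseteq> polys V"
    using V by (auto intro!: polys_closed var_in_polys)
  show "edge_ideal V E \<subseteq> ?J"
    unfolding edge_ideal_def
  proof (intro genideal_minimal ideal_monomials)
    show "?S \<subseteq> ?J"
    proof
      fix p :: "('a, 'b) mpol" assume p: "p \<in> ?S"
      then obtain i j where ij: "p = var i * var j" "{i, j} \<in> E"
        by blast
      then have "\<exists>e\<in>E. e \<subseteq> keys m" if "m \<in> keys p" for m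
        using that by (intro bexI[of _ "{i, j}"]) (auto simp: var_def mult_single keys_add_nat)
      then show "p \<in> ?J"
        using S p by blast
    qed
  qed (auto simp: keys_add_nat)
  interpret I: ideal "Idl\<^bsub>poly_ring V\<^esub> ?S" "poly_ring V"
    using S by (intro genideal_ideal) (auto simp: poly_ring_def)
  show "?J \<subseteq> edge_ideal V E"
  proof
    fix p :: "('a, 'b) mpol" assume p: "p \<in> ?J"
    have mon: "Poly_Mapping.single m (lookup p m) \<in> edge_ideal V E" if m: "m \<in> keys p" for m
    proof -
      obtain e where "e \<in> E" "e \<subseteq> keys m"
        using p m by auto
      then obtain i j where ij: "{i, j} \<in> E" "i \<in> keys m" "j \<in> keys m"
        using simple_graph_edgeE[OF G] by (metis insert_subset)
      let ?m = "Poly_Mapping.single i 1 + Poly_Mapping.single j (1 :: nat)"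
      \<comment> \<open>Subtraction of exponents truncates at zero. Nothing is lost here, since
        \<open>i\<close> and \<open>j\<close> are distinct and both occur in
        \<open>m\<close>.\<close>
      have "m - ?m + ?m = m"
        using ij V[OF ij(1)]
        by (auto simp: poly_mapping_eq_iff fun_eq_iff lookup_add lookup_minus lookup_single when_def in_keys_iff)
      then have "Poly_Mapping.single m (lookup p m) =
          Poly_Mapping.single (m - ?m) (lookup p m) * (var i * var j)"
        by (simp add: var_def mult_single)
      moreover have "Poly_Mapping.single (m - ?m) (lookup p m) \<in> polys V"
        using p m by (auto simp: polys_def in_keys_iff lookup_minus subset_iff)
      moreover have "var i * var j \<in> (edge_ideal V E :: ('a, 'b) mpol set)"
      proof -
        have "var i * var j \<in> ?S"
          using ij(1) by blast
        moreover have "?S \<subseteq> edge_ideal V E"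
          unfolding edge_ideal_def using S by (intro genideal_self) (simp add: poly_ring_simps)
        ultimately show ?thesis by blast
      qed
      ultimately show ?thesis
        using I.I_l_closed by (simp add: poly_ring_def edge_ideal_def)
    qed
    have "(\<Sum>m\<in>A. Poly_Mapping.single m (lookup p m)) \<in> edge_ideal V E"
      if "finite A" "A \<subseteq> keys p" for A
      using that
    proof (induction A rule: finite_induct)
      case empty
      then show ?case
        using I.zero_closed by (simp add: edge_ideal_def poly_ring_def)
    next
      case (insert m A)
      then show ?case
        using mon[of m] I.a_closed by (simp add: edge_ideal_def poly_ring_def)
    qed
    then show "p \<in> edge_ideal V E"
      by (subst mpol_sum_monomials) simp
  qed
qed

section \<open>Decomposition of the Koszul complex by multidegree\<close>

definition chi :: "'v set \<Rightarrow> ('v \<Rightarrow>\<^sub>0 nat)" where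
  "chi F = (\<Sum>v\<in>F. Poly_Mapping.single v 1)"

lemma chi_empty [simp]: "chi {} = 0"
  by (simp add: chi_def)

lemma chi_insert: "finite F \<Longrightarrow> v \<notin> F \<Longrightarrow> chi (insert v F) = Poly_Mapping.single v 1 + chi F"
  by (simp add: chi_def)

lemma lookup_chi: "finite F \<Longrightarrow> lookup (chi F) v = (if v \<in> F then 1 else 0)"
  by (simp add: chi_def lookup_sum lookup_single when_def)

lemma keys_chi [simp]: "finite F \<Longrightarrow> keys (chi F) = F"
  by (auto simp: in_keys_iff lookup_chi split: if_splits)

lemma monom_deg_chi [simp]: "finite F \<Longrightarrow> monom_deg (chi F) = card F"
  by (simp add: monom_deg_def lookup_chi)

lemma diff_chi_add: "finite F \<Longrightarrow> F \<subseteq> keys m \<Longrightarrow> m - chi F + chi F = m"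
  by (auto simp: poly_mapping_eq_iff fun_eq_iff lookup_add lookup_minus lookup_chi in_keys_iff)

context vertex_indexing
begin

lemma lookup_sg_mult: "lookup (sg v F * p) m = sg v F * lookup (p :: ('v, 'k::field) mpol) m"
proof -
  have "lookup ((-1) ^ n * p) m = (-1) ^ n * lookup p m" for n
    by (induction n) auto
  then show ?thesis
    by (simp add: sg_def)
qed

text \<open>The basis element \<open>x\<^sup>m e\<^sub>F\<close> of the Koszul complex has multidegree \<open>m + chi F\<close>.\<close>

definition slice :: "('v set \<Rightarrow> ('v, 'k::field) mpol) \<Rightarrow> ('v \<Rightarrow>\<^sub>0 nat) \<Rightarrow> 'v set \<Rightarrow> 'k" where
  "slice c \<mu> F = (if F \<subseteq> V \<and> F \<subseteq> keys \<mu> then lookup (c F) (\<mu> - chi F) else 0)"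

lemma slice_add_chi: "F \<subseteq> V \<Longrightarrow> slice c (m + chi F) F = lookup (c F) m"
  using finite_subset[OF _ finite_V] by (simp add: slice_def keys_add_nat)

text \<open>The Koszul differential preserves multidegrees: dropping \<open>v\<close> from the face
  is balanced by the factor \<open>var v\<close>. Within one multidegree it is the simplicial
  boundary.\<close>

lemma lookup_kos:
  assumes F: "F \<subseteq> V"
  shows "lookup (kos var c F) m = bd (slice c (m + chi F)) F"
proof -
  have fin: "finite F"
    using F finite_V finite_subset by blast
  have "lookup (var v * c (insert v F)) m = slice c (m + chi F) (insert v F)" if "v \<in> V - F" for v
  proof -
    have "m + chi F - chi (insert v F) = m - Poly_Mapping.single v 1"
      using that fin by (simp add: chi_insert)
    then show ?thesis
      using that fin F by (auto simp: lookup_var_mult slice_def keys_add_nat)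
  qed
  then show ?thesis
    by (simp add: kos_def lookup_sum lookup_sg_mult)
qed

text \<open>The equation is solved in each multidegree \<open>\<mu>\<close> separately and the
  solutions are reassembled. A coefficient of degree at least \<open>t\<close> on \<open>F\<close>
  in multidegree \<open>\<mu>\<close> amounts to \<open>card F \<le> monom_deg \<mu> - t\<close>, so
  one more vertex in \<open>F\<close> costs one in the degree, whence \<open>t - 1\<close>.\<close>

lemma koszul_exact_multigraded:
  fixes c :: "'v set \<Rightarrow> ('v, 'k::field) mpol"
  assumes c: "\<And>F m. F \<subseteq> V \<Longrightarrow> m \<in> keys (c F) \<Longrightarrow> keys m \<subseteq> V \<and> Q m \<and> int (monom_deg m) \<ge> t"
    and const: "lookup (c {}) 0 = 0"
    and cyc: "\<And>F. F \<subseteq> V \<Longrightarrow> kos var c F = 0"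
    and ac: "\<And>\<mu>. keys \<mu> \<subseteq> V \<Longrightarrow> \<mu> \<noteq> 0 \<Longrightarrow>
      acyclic_upto TYPE('k) {F. F \<subseteq> keys \<mu> \<and> Q (\<mu> - chi F)} (int (monom_deg \<mu>) - t)"
  obtains b where
    "\<And>F m. F \<subseteq> V \<Longrightarrow> m \<in> keys (b F) \<Longrightarrow> keys m \<subseteq> V \<and> Q m \<and> int (monom_deg m) \<ge> t - 1"
    and "\<And>F. F \<subseteq> V \<Longrightarrow> kos var b F = c F"
proof -
  have fin: "finite F" if "F \<subseteq> V" for F
    using that finite_V finite_subset by blast
  \<comment> \<open>The last clause confines nonzero choices to the finitely many multidegrees
    occurring in \<open>c\<close>, so that they can be assembled into polynomials.\<close>
  define P where "P \<mu> g \<longleftrightarrow>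
      supported g {F. F \<subseteq> keys \<mu> \<and> Q (\<mu> - chi F)} (int (monom_deg \<mu>) - t + 1) \<and>
      (\<forall>F. bd g F = slice c \<mu> F) \<and>
      (g = (\<lambda>_. 0) \<or> keys \<mu> \<subseteq> V \<and> (\<exists>F\<subseteq>V. \<exists>m\<in>keys (c F). \<mu> = m + chi F))" for \<mu> g
  have "\<exists>g. P \<mu> g" for \<mu>
  proof (cases "slice c \<mu> = (\<lambda>_. 0)")
    case True
    then show ?thesis
      by (intro exI[of _ "\<lambda>_. 0"]) (simp add: P_def supported_def kos_def)
  next
    case False
    have slice: "keys \<mu> \<subseteq> V \<and> Q (\<mu> - chi F) \<and> int (card F) \<le> int (monom_deg \<mu>) - t \<and>
        \<mu> - chi F \<in> keys (c F) \<and> \<mu> = (\<mu> - chi F) + chi F \<and> F \<subseteq> V \<and> F \<subseteq> keys \<mu>"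
      if "slice c \<mu> F \<noteq> 0" for F
    proof -
      have F: "F \<subseteq> V" "F \<subseteq> keys \<mu>" "\<mu> - chi F \<in> keys (c F)"
        using that by (auto simp: slice_def in_keys_iff split: if_splits)
      have \<mu>: "\<mu> = (\<mu> - chi F) + chi F"
        using F fin by (simp add: diff_chi_add)
      have "keys \<mu> = keys (\<mu> - chi F) \<union> F" "monom_deg \<mu> = monom_deg (\<mu> - chi F) + card F"
        using F fin by (subst \<mu>, simp add: keys_add_nat monom_deg_add)+
      then show ?thesis
        using c[OF F(1,3)] F \<mu> by auto
    qed
    obtain F where F: "slice c \<mu> F \<noteq> 0"
      using False by auto
    \<comment> \<open>In multidegree 0 only the empty face is possible, and its coefficient is the
      constant term excluded by \<open>const\<close>.\<close>
    have "\<mu> \<noteq> 0"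
    proof
      assume "\<mu> = 0"
      with slice[OF F] have "F = {}" by auto
      with F \<open>\<mu> = 0\<close> const show False by (simp add: slice_def)
    qed
    moreover have "supported (slice c \<mu>) {F. F \<subseteq> keys \<mu> \<and> Q (\<mu> - chi F)} (int (monom_deg \<mu>) - t)"
      unfolding supported_def using slice by blast
    moreover have "bd (slice c \<mu>) F = 0" for F
    proof (cases "F \<subseteq> V \<and> F \<subseteq> keys \<mu>")
      case True
      then show ?thesis
        using lookup_kos[of F c "\<mu> - chi F"] cyc[of F] fin[of F] by (simp add: diff_chi_add)
    next
      case False
      then have "slice c \<mu> (insert v F) = 0" for v
        by (auto simp: slice_def)
      then show ?thesis
        by (simp add: kos_def)
    qed
    ultimately obtain g where
      "supported g {F. F \<subseteq> keys \<mu> \<and> Q (\<mu> - chi F)} (int (monom_deg \<mu>) - t + 1)"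
      "\<forall>F. bd g F = slice c \<mu> F"
      using ac[of \<mu>] slice[OF F] unfolding acyclic_upto_def by blast
    then have "P \<mu> g"
      using slice[OF F] unfolding P_def by blast
    then show ?thesis by blast
  qed
  then obtain g where "\<And>\<mu>. P \<mu> (g \<mu>)"
    by metis
  then have supp: "\<And>\<mu>. supported (g \<mu>) {F. F \<subseteq> keys \<mu> \<and> Q (\<mu> - chi F)} (int (monom_deg \<mu>) - t + 1)"
    and g: "\<And>\<mu> F. bd (g \<mu>) F = slice c \<mu> F"
    and ne: "\<And>\<mu>. g \<mu> = (\<lambda>_. 0) \<or>
        keys \<mu> \<subseteq> V \<and> (\<exists>F\<subseteq>V. \<exists>m\<in>keys (c F). \<mu> = m + chi F)"
    unfolding P_def by blast+
  define b where "b F = Abs_poly_mapping (\<lambda>m. g (m + chi F) F)" for F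
  have b: "lookup (b F) m = g (m + chi F) F" for F m
  proof -
    \<comment> \<open>\<open>U\<close> is the finite set of multidegrees occurring in
      \<open>c\<close>. Since adding \<open>chi F\<close> is injective, only finitely many
      \<open>m\<close> give a nonzero coefficient.\<close>
    define U where "U = (\<Union>F\<in>Pow V. (\<lambda>m. m + chi F) ` keys (c F))"
    have "finite U"
      using finite_V by (simp add: U_def)
    then have "finite ((\<lambda>m. m + chi F) -` U)"
      by (rule finite_vimageI) (simp add: inj_def)
    moreover have "{m. g (m + chi F) F \<noteq> 0} \<subseteq> (\<lambda>m. m + chi F) -` U"
    proof
      fix m assume "m \<in> {m. g (m + chi F) F \<noteq> 0}"
      then show "m \<in> (\<lambda>m. m + chi F) -` U"
        using ne[of "m + chi F"] by (auto simp: U_def)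
    qed
    ultimately show ?thesis
      unfolding b_def using finite_subset by (subst lookup_Abs_poly_mapping) auto
  qed
  have slice_b: "slice b \<mu> F = g \<mu> F" for \<mu> F
  proof (cases "F \<subseteq> V \<and> F \<subseteq> keys \<mu>")
    case True
    then show ?thesis
      using fin by (simp add: slice_def b diff_chi_add)
  next
    case False
    then have "g \<mu> F = 0"
      using supp[of \<mu>] ne[of \<mu>] unfolding supported_def by fastforce
    then show ?thesis
      using False by (auto simp: slice_def)
  qed
  show thesis
  proof
    fix F m assume F: "F \<subseteq> V" and "m \<in> keys (b F)"
    then have *: "g (m + chi F) F \<noteq> 0"
      by (simp add: in_keys_iff b)
    then show "keys m \<subseteq> V \<and> Q m \<and> int (monom_deg m) \<ge> t - 1"
    proof -
      have "Q (m + chi F - chi F)" "int (card F) \<le> int (monom_deg (m + chi F)) - t + 1"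
        using supp[of "m + chi F"] * unfolding supported_def by blast+
      moreover have "keys (m + chi F) \<subseteq> V"
        using ne[of "m + chi F"] * by auto
      ultimately show ?thesis
        using fin[OF F] by (simp add: monom_deg_add keys_add_nat)
    qed
  next
    fix F assume F: "F \<subseteq> V"
    show "kos var b F = c F"
    proof (rule poly_mapping_eqI)
      fix m
      have "slice b (m + chi F) = g (m + chi F)"
        using slice_b by auto
      then show "lookup (kos var b F) m = lookup (c F) m"
        by (simp add: lookup_kos F g slice_add_chi)
    qed
  qed
qed

text \<open>In a multidegree \<open>\<mu> \<noteq> 0\<close> the complex is the full simplex on
  \<open>keys \<mu>\<close>, a cone over any of its vertices. The condition \<open>const\<close>
  rules out the one homology class of the Koszul complex of the ring, that of the constants on the
  empty set.\<close>

lemma koszul_exact_free: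
  fixes c :: "'v set \<Rightarrow> ('v, 'k::field) mpol"
  assumes c: "\<And>F. F \<subseteq> V \<Longrightarrow> c F \<in> polys V"
    and deg: "\<And>F m. F \<subseteq> V \<Longrightarrow> m \<in> keys (c F) \<Longrightarrow> int (monom_deg m) \<ge> t"
    and const: "lookup (c {}) 0 = 0"
    and cyc: "\<And>F. F \<subseteq> V \<Longrightarrow> kos var c F = 0"
  obtains b where "\<And>F. F \<subseteq> V \<Longrightarrow> b F \<in> polys V"
    and "\<And>F m. F \<subseteq> V \<Longrightarrow> m \<in> keys (b F) \<Longrightarrow> int (monom_deg m) \<ge> t - 1"
    and "\<And>F. F \<subseteq> V \<Longrightarrow> kos var b F = c F"
proof (rule koszul_exact_multigraded[of c "\<lambda>_. True" t])
  show "keys m \<subseteq> V \<and> True \<and> int (monom_deg m) \<ge> t" if "F \<subseteq> V" "m \<in> keys (c F)" for F m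
    using c[OF that(1)] deg[OF that] that(2) by (auto simp: polys_def)
  show "acyclic_upto TYPE('k) {F. F \<subseteq> keys \<mu> \<and> True} (int (monom_deg \<mu>) - t)"
    if "keys \<mu> \<subseteq> V" "\<mu> \<noteq> 0" for \<mu>
  proof -
    obtain v where "v \<in> keys \<mu>"
      using \<open>\<mu> \<noteq> 0\<close> by (metis ex_in_conv poly_mapping_eqI lookup_zero in_keys_iff)
    then show ?thesis
      using that by (intro acyclic_upto_cone[of v]) auto
  qed
  fix b :: "'v set \<Rightarrow> ('v, 'k) mpol"
  assume "\<And>F m. F \<subseteq> V \<Longrightarrow> m \<in> keys (b F) \<Longrightarrow> keys m \<subseteq> V \<and> True \<and> t - 1 \<le> int (monom_deg m)"
    and "\<And>F. F \<subseteq> V \<Longrightarrow> kos var b F = c F"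
  then show thesis
    by (intro that[of b]) (auto simp: polys_def)
qed (use assms in auto)

lemma koszul_exact_edge_ideal:
  fixes c :: "'v set \<Rightarrow> ('v, 'k::field) mpol"
  assumes G: "simple_graph V E" "claw_free V E" "\<not> has_induced_4_cycle V (complement_edges V E)"
    and c: "\<And>F. F \<subseteq> V \<Longrightarrow> c F \<in> edge_ideal V E"
    and deg: "\<And>F m. F \<subseteq> V \<Longrightarrow> m \<in> keys (c F) \<Longrightarrow> int (monom_deg m) \<ge> 4"
    and cyc: "\<And>F. F \<subseteq> V \<Longrightarrow> kos var c F = 0"
  obtains b where "\<And>F. F \<subseteq> V \<Longrightarrow> b F \<in> edge_ideal V E"
    and "\<And>F. F \<subseteq> V \<Longrightarrow> kos var b F = c F"
proof (rule koszul_exact_multigraded[of c "\<lambda>m. \<exists>e\<in>E. e \<subseteq> keys m" 4])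
  show "keys m \<subseteq> V \<and> (\<exists>e\<in>E. e \<subseteq> keys m) \<and> int (monom_deg m) \<ge> 4"
    if "F \<subseteq> V" "m \<in> keys (c F)" for F m
    using c[OF that(1)] deg[OF that] that(2) by (auto simp: polys_def edge_ideal_eq[OF G(1)])
  show "lookup (c {}) 0 = 0"
    using deg[of "{}" 0] by (auto simp: monom_deg_def in_keys_iff)
  show "acyclic_upto TYPE('k) {F. F \<subseteq> keys \<mu> \<and> (\<exists>e\<in>E. e \<subseteq> keys (\<mu> - chi F))} (int (monom_deg \<mu>) - 4)"
    if \<mu>: "keys \<mu> \<subseteq> V" for \<mu>
  proof -
    have fin: "finite F" if "F \<subseteq> keys \<mu>" for F
      using that finite_keys finite_subset by blast
    have keys: "keys (\<mu> - chi F) = {v \<in> keys \<mu>. v \<in> F \<longrightarrow> lookup \<mu> v \<ge> 2}" if "F \<subseteq> keys \<mu>" for F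
      using fin[OF that] by (auto simp: in_keys_iff lookup_minus lookup_chi)
    show ?thesis
    proof (cases "\<exists>v. lookup \<mu> v \<ge> 2")
      case True
      then obtain v where v: "lookup \<mu> v \<ge> 2" ..
      then have "v \<in> keys \<mu>"
        by (auto simp: in_keys_iff)
      \<comment> \<open>An exponent of at least 2 stays positive after losing 1, so the support does
        not notice whether \<open>v\<close> belongs to \<open>F\<close>. Hence \<open>v\<close> is a
        cone apex.\<close>
      moreover have "keys (\<mu> - chi (insert v F)) = keys (\<mu> - chi F)" if "F \<subseteq> keys \<mu>" for F
        using keys[of F] keys[of "insert v F"] that v \<open>v \<in> keys \<mu>\<close> by auto
      ultimately show ?thesis
        using \<mu> by (intro acyclic_upto_cone[of v]) auto
    next
      case False
      have "lookup \<mu> v = 1" if "v \<in> keys \<mu>" for v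
      proof -
        have "\<not> lookup \<mu> v \<ge> 2" "lookup \<mu> v \<noteq> 0"
          using False that by (simp_all add: in_keys_iff)
        then show ?thesis by linarith
      qed
      then have "monom_deg \<mu> = card (keys \<mu>)"
        by (simp add: monom_deg_def)
      moreover have "keys (\<mu> - chi F) = keys \<mu> - F" if "F \<subseteq> keys \<mu>" for F
        using keys[OF that] False by auto
      then have "{F. F \<subseteq> keys \<mu> \<and> (\<exists>e\<in>E. e \<subseteq> keys (\<mu> - chi F))} = edge_complex E (keys \<mu>) {}"
        unfolding edge_complex_def by (intro Collect_cong conj_cong refl) simp
      ultimately show ?thesis
        using acyclic_upto_gap_free_claw_free[OF G \<mu>, where 'a = 'k] by simp
    qed
  qed
  fix b :: "'v set \<Rightarrow> ('v, 'k) mpol"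
  assume "\<And>F m. F \<subseteq> V \<Longrightarrow> m \<in> keys (b F) \<Longrightarrow>
      keys m \<subseteq> V \<and> (\<exists>e\<in>E. e \<subseteq> keys m) \<and> 4 - 1 \<le> int (monom_deg m)"
    and "\<And>F. F \<subseteq> V \<Longrightarrow> kos var b F = c F"
  then show thesis
    by (intro that[of b]) (auto simp: polys_def edge_ideal_eq[OF G(1)])
qed (use assms in auto)

end


section \<open>Dimension shifting along a minimal resolution\<close>

lemma polys_sum: "(\<And>i. i \<in> A \<Longrightarrow> f i \<in> polys V) \<Longrightarrow> (\<Sum>i\<in>A. f i) \<in> polys V"
  by (induction A rule: infinite_finite_induct) (auto simp: polys_closed)

lemma lookup_mult_const: "lookup p 0 = 0 \<Longrightarrow> lookup (p * q :: ('v, 'k::field) mpol) 0 = 0"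
proof -
  assume p: "lookup p 0 = 0"
  have "a \<notin> keys p" if "0 = a + b" for a b
  proof -
    have "keys a = {}"
      using arg_cong[OF that, of keys] by (simp add: keys_add_nat)
    then have "a = 0"
      by (intro poly_mapping_eqI) (auto simp: in_keys_iff)
    then show ?thesis
      using p by (simp add: in_keys_iff)
  qed
  then have "0 \<notin> keys (p * q)"
    using keys_mult[of p q] by blast
  then show ?thesis
    by (simp add: in_keys_iff)
qed

context vertex_indexing
begin

lemma kos_cong: "(\<And>F. F \<subseteq> V \<Longrightarrow> f F = g F) \<Longrightarrow> F \<subseteq> V \<Longrightarrow> kos w f F = kos w g F"
  unfolding kos_def by (intro sum.cong refl) auto

lemma sg_in_polys: "(sg v F :: ('v, 'k::field) mpol) \<in> polys V"
proof -
  have "(-1) ^ n \<in> (polys V :: ('v, 'k) mpol set)" for n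
    by (induction n) (auto simp: polys_closed)
  then show ?thesis
    by (simp add: sg_def)
qed

lemma kos_in_polys: "(\<And>F. F \<subseteq> V \<Longrightarrow> c F \<in> polys V) \<Longrightarrow> F \<subseteq> V \<Longrightarrow> kos var c F \<in> polys V"
  unfolding kos_def by (intro polys_sum polys_closed(5) sg_in_polys var_in_polys) auto

lemma lookup_kos_const: "lookup (kos var c F) 0 = 0"
  by (simp add: kos_def lookup_sum lookup_sg_mult lookup_var_mult)

end

text \<open>
  Indices are shifted by one against \<open>graded_free_resolution\<close>: position \<open>0\<close> is the ring itself, so that
  the augmentation is treated like the other differentials.
\<close>

locale minimal_resolution = vertex_indexing V idx
  for V :: "'v set" and idx :: "'v \<Rightarrow> nat" +
  fixes I :: "('v, 'k::field) mpol set" and rk :: "nat \<Rightarrow> nat" and A :: "nat \<Rightarrow> nat \<Rightarrow> int"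
    and d :: "nat \<Rightarrow> nat \<Rightarrow> nat \<Rightarrow> ('v, 'k) mpol"
  assumes rk_0: "rk 0 = 1" and A_0: "A 0 0 = 0"
    and d_polys: "r < rk i \<Longrightarrow> l < rk (Suc i) \<Longrightarrow> d i r l \<in> polys V"
    and d_homogeneous: "r < rk i \<Longrightarrow> l < rk (Suc i) \<Longrightarrow> homogeneous (A (Suc i) l - A i r) (d i r l)"
    and d_minimal: "r < rk (Suc i) \<Longrightarrow> l < rk (Suc (Suc i)) \<Longrightarrow> lookup (d (Suc i) r l) 0 = 0"
    and image: "p \<in> I \<longleftrightarrow> (\<exists>x. (\<forall>l<rk 1. x l \<in> polys V) \<and> p = (\<Sum>l<rk 1. d 0 0 l * x l))"
    and complex: "(\<And>l. l < rk (Suc (Suc i)) \<Longrightarrow> y l \<in> polys V) \<Longrightarrow> r < rk i \<Longrightarrow>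
      (\<Sum>k<rk (Suc i). d i r k * (\<Sum>l<rk (Suc (Suc i)). d (Suc i) k l * y l)) = 0"
    and exact: "(\<And>l. l < rk (Suc i) \<Longrightarrow> x l \<in> polys V) \<Longrightarrow>
      (\<And>r. r < rk i \<Longrightarrow> (\<Sum>l<rk (Suc i). d i r l * x l) = 0) \<Longrightarrow>
      \<exists>y. (\<forall>l<rk (Suc (Suc i)). y l \<in> polys V) \<and>
        (\<forall>l<rk (Suc i). x l = (\<Sum>k<rk (Suc (Suc i)). d (Suc i) l k * y k))"
begin

text \<open>The differential from position \<open>i + 1\<close> to position \<open>i\<close>.
  Vectors are functions on all naturals, of which only the values below the rank matter.\<close>

definition app :: "nat \<Rightarrow> (nat \<Rightarrow> ('v, 'k) mpol) \<Rightarrow> nat \<Rightarrow> ('v, 'k) mpol" where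
  "app i x r = (\<Sum>l<rk (Suc i). d i r l * x l)"

lemma app_cong: "(\<And>l. l < rk (Suc i) \<Longrightarrow> x l = y l) \<Longrightarrow> app i x r = app i y r"
  by (simp add: app_def)

lemma app_diff: "app i (\<lambda>l. x l - y l) r = app i x r - app i y r"
  by (simp add: app_def algebra_simps sum_subtractf)

lemma app_in_polys:
  "r < rk i \<Longrightarrow> (\<And>l. l < rk (Suc i) \<Longrightarrow> x l \<in> polys V) \<Longrightarrow> app i x r \<in> polys V"
  unfolding app_def by (intro polys_sum polys_closed(5) d_polys) auto

lemma app_app: "(\<And>l. l < rk (Suc (Suc i)) \<Longrightarrow> y l \<in> polys V) \<Longrightarrow> r < rk i \<Longrightarrow> app i (app (Suc i) y) r = 0"
  unfolding app_def by (rule complex)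

lemma app_exact:
  assumes "\<And>l. l < rk (Suc i) \<Longrightarrow> x l \<in> polys V" and "\<And>r. r < rk i \<Longrightarrow> app i x r = 0"
  obtains y where "\<And>l. l < rk (Suc (Suc i)) \<Longrightarrow> y l \<in> polys V"
    and "\<And>l. l < rk (Suc i) \<Longrightarrow> x l = app (Suc i) y l"
  using exact[of i x] assms unfolding app_def by blast

lemma lookup_app_const: "r < rk (Suc i) \<Longrightarrow> lookup (app (Suc i) y r) 0 = 0"
  by (simp add: app_def lookup_sum lookup_mult_const d_minimal)

text \<open>The internal degree \<open>monom_deg m + A i r\<close> of a term is preserved by the
  differential, because the entry \<open>d i r l\<close> is homogeneous of the difference of the
  generator degrees.\<close>

lemma app_degree:
  assumes r: "r < rk i" and m: "m \<in> keys (app i x r)"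
    and x: "\<And>l m. l < rk (Suc i) \<Longrightarrow> m \<in> keys (x l) \<Longrightarrow> int (monom_deg m) + A (Suc i) l \<ge> t"
  shows "int (monom_deg m) + A i r \<ge> t"
proof -
  have "(\<Sum>l<rk (Suc i). lookup (d i r l * x l) m) \<noteq> 0"
    using m by (simp add: app_def in_keys_iff lookup_sum)
  then obtain l where l: "l < rk (Suc i)" "m \<in> keys (d i r l * x l)"
    by (metis (no_types, lifting) in_keys_iff lessThan_iff sum.neutral)
  then obtain m1 m2 where m: "m = m1 + m2" "m1 \<in> keys (d i r l)" "m2 \<in> keys (x l)"
    using keys_mult[of "d i r l" "x l"] by blast
  have "int (monom_deg m1) = A (Suc i) l - A i r"
    using d_homogeneous[OF r l(1)] m(2) by (simp add: homogeneous_def)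
  then show ?thesis
    using x[OF l(1) m(3)] by (simp add: m(1) monom_deg_add)
qed

text \<open>The differential of the resolution is linear over the ring, so it commutes with the
  Koszul differential, as in a double complex.\<close>

lemma kos_app: "kos var (\<lambda>F. app i (b F) r) F = app i (\<lambda>l. kos var (\<lambda>F. b F l) F) r"
proof -
  have "kos var (\<lambda>F. app i (b F) r) F =
      (\<Sum>v\<in>V - F. \<Sum>l<rk (Suc i). d i r l * (sg v F * (var v * b (insert v F) l)))"
    by (simp add: kos_def app_def sum_distrib_left mult_ac)
  also have "\<dots> = (\<Sum>l<rk (Suc i). \<Sum>v\<in>V - F. d i r l * (sg v F * (var v * b (insert v F) l)))"
    by (rule sum.swap)
  finally show ?thesis
    by (simp add: kos_def app_def sum_distrib_left)
qed

text \<open>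
  The coefficients are in the image \<open>M\<^sub>i\<close> of \<open>d i\<close>.  Chains of all sizes are treated at once, since the
  bound on the degrees of the coefficients does not depend on the size.
\<close>

definition koszul_exact :: "int \<Rightarrow> nat \<Rightarrow> bool" where
  "koszul_exact s i \<longleftrightarrow>
     (\<forall>b. (\<forall>F\<subseteq>V. \<forall>l<rk (Suc i). b F l \<in> polys V) \<longrightarrow>
          (\<forall>F\<subseteq>V. \<forall>r<rk i. kos var (\<lambda>F. app i (b F) r) F = 0) \<longrightarrow>
          (\<forall>F\<subseteq>V. \<forall>r<rk i. \<forall>m\<in>keys (app i (b F) r). int (monom_deg m) + A i r \<ge> int i + s) \<longrightarrow>
          (\<exists>b'. (\<forall>F\<subseteq>V. \<forall>l<rk (Suc i). b' F l \<in> polys V) \<and>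
                (\<forall>F\<subseteq>V. \<forall>r<rk i. app i (b F) r = kos var (\<lambda>F. app i (b' F) r) F)))"

lemma koszul_exactD:
  assumes "koszul_exact s i"
    and "\<And>F l. F \<subseteq> V \<Longrightarrow> l < rk (Suc i) \<Longrightarrow> b F l \<in> polys V"
    and "\<And>F r. F \<subseteq> V \<Longrightarrow> r < rk i \<Longrightarrow> kos var (\<lambda>F. app i (b F) r) F = 0"
    and "\<And>F r m. F \<subseteq> V \<Longrightarrow> r < rk i \<Longrightarrow> m \<in> keys (app i (b F) r) \<Longrightarrow>
      int (monom_deg m) + A i r \<ge> int i + s"
  shows "\<exists>b'. (\<forall>F\<subseteq>V. \<forall>l<rk (Suc i). b' F l \<in> polys V) \<and>
    (\<forall>F\<subseteq>V. \<forall>r<rk i. app i (b F) r = kos var (\<lambda>F. app i (b' F) r) F)"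
  by (rule assms(1)[unfolded koszul_exact_def, rule_format]) (fact assms)+

text \<open>A diagram chase along the sequence of syzygies. The cycle bounds some \<open>h\<close>
  in the free module, and \<open>h\<close> maps to a cycle with coefficients in the previous syzygy
  module. By hypothesis this image bounds some \<open>b'\<close>. Correcting \<open>h\<close> by the
  Koszul boundary of \<open>b'\<close> moves it into the kernel, hence into the next image. The
  degree bound falls by one in passing to \<open>h\<close>, which is why it has the form
  \<open>int i + s\<close>.\<close>

lemma koszul_exact_Suc:
  assumes IH: "koszul_exact s i"
  shows "koszul_exact s (Suc i)"
  unfolding koszul_exact_def
proof (intro allI impI)
  fix b :: "'v set \<Rightarrow> nat \<Rightarrow> ('v, 'k) mpol"
  assume b: "\<forall>F\<subseteq>V. \<forall>l<rk (Suc (Suc i)). b F l \<in> polys V"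
    and cyc: "\<forall>F\<subseteq>V. \<forall>r<rk (Suc i). kos var (\<lambda>F. app (Suc i) (b F) r) F = 0"
    and deg: "\<forall>F\<subseteq>V. \<forall>r<rk (Suc i). \<forall>m\<in>keys (app (Suc i) (b F) r).
      int (monom_deg m) + A (Suc i) r \<ge> int (Suc i) + s"
  define P where "P l h \<longleftrightarrow> (\<forall>F\<subseteq>V. h F \<in> polys V) \<and>
      (\<forall>F\<subseteq>V. \<forall>m\<in>keys (h F). int (monom_deg m) + A (Suc i) l \<ge> int i + s) \<and>
      (\<forall>F\<subseteq>V. kos var h F = app (Suc i) (b F) l)" for l h
  have "\<exists>h. P l h" if l: "l < rk (Suc i)" for l
  proof (rule koszul_exact_free[of "\<lambda>F. app (Suc i) (b F) l" "int (Suc i) + s - A (Suc i) l"])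
    show "app (Suc i) (b F) l \<in> polys V" if "F \<subseteq> V" for F
      using b l that by (intro app_in_polys) auto
    show "int (Suc i) + s - A (Suc i) l \<le> int (monom_deg m)"
      if "F \<subseteq> V" "m \<in> keys (app (Suc i) (b F) l)" for F m
      using deg[rule_format, OF that(1) l that(2)] by simp
    \<comment> \<open>Minimality is used here: the coefficients of the cycle have no constant
      term.\<close>
    show "lookup (app (Suc i) (b {}) l) 0 = 0"
      using l by (rule lookup_app_const)
    show "kos var (\<lambda>F. app (Suc i) (b F) l) F = 0" if "F \<subseteq> V" for F
      using cyc l that by blast
    fix h :: "'v set \<Rightarrow> ('v, 'k) mpol"
    assume h: "\<And>F. F \<subseteq> V \<Longrightarrow> h F \<in> polys V"
      and h_deg: "\<And>F m. F \<subseteq> V \<Longrightarrow> m \<in> keys (h F) \<Longrightarrow> int (Suc i) + s - A (Suc i) l - 1 \<le> int (monom_deg m)"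
      and kos_h: "\<And>F. F \<subseteq> V \<Longrightarrow> kos var h F = app (Suc i) (b F) l"
    have "int (monom_deg m) + A (Suc i) l \<ge> int i + s" if "F \<subseteq> V" "m \<in> keys (h F)" for F m
      using h_deg[OF that] by simp
    then have "P l h"
      using h kos_h unfolding P_def by blast
    then show ?thesis by blast
  qed
  then obtain h where "\<And>l. l < rk (Suc i) \<Longrightarrow> P l (h l)"
    by metis
  then have h: "\<And>l F. l < rk (Suc i) \<Longrightarrow> F \<subseteq> V \<Longrightarrow> h l F \<in> polys V"
    and h_deg: "\<And>l F m. l < rk (Suc i) \<Longrightarrow> F \<subseteq> V \<Longrightarrow> m \<in> keys (h l F) \<Longrightarrow>
      int (monom_deg m) + A (Suc i) l \<ge> int i + s"
    and kos_h: "\<And>l F. l < rk (Suc i) \<Longrightarrow> F \<subseteq> V \<Longrightarrow> kos var (h l) F = app (Suc i) (b F) l"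
    by (simp_all add: P_def)
  have "h l F \<in> polys V" if "F \<subseteq> V" "l < rk (Suc i)" for F l
    using h that by blast
  moreover have "kos var (\<lambda>F. app i (\<lambda>l. h l F) r) F = 0" if "F \<subseteq> V" "r < rk i" for F r
  proof -
    have "kos var (\<lambda>F. app i (\<lambda>l. h l F) r) F = app i (\<lambda>l. app (Suc i) (b F) l) r"
      unfolding kos_app using kos_h that(1) by (intro app_cong) simp
    also have "\<dots> = 0"
      using b that by (intro app_app) auto
    finally show ?thesis .
  qed
  moreover have "int (monom_deg m) + A i r \<ge> int i + s"
    if "F \<subseteq> V" "r < rk i" "m \<in> keys (app i (\<lambda>l. h l F) r)" for F r m
    using app_degree[OF that(2,3)] h_deg that(1) by blast
  ultimately obtain b' where
      b': "\<forall>F\<subseteq>V. \<forall>l<rk (Suc i). b' F l \<in> polys V"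
      and app_h: "\<forall>F\<subseteq>V. \<forall>r<rk i. app i (\<lambda>l. h l F) r = kos var (\<lambda>F. app i (b' F) r) F"
    using koszul_exactD[OF IH, of "\<lambda>F l. h l F"] by auto
  \<comment> \<open>The correction does not change the Koszul boundary, as \<open>kos\<close>
    squares to zero, and it makes the image under \<open>app i\<close> vanish.\<close>
  define x where "x F l = h l F - kos var (\<lambda>F. b' F l) F" for F l
  have x: "x F l \<in> polys V" if "F \<subseteq> V" "l < rk (Suc i)" for F l
  proof -
    have "h l F + - kos var (\<lambda>F. b' F l) F \<in> polys V"
      using h b' that by (intro polys_closed kos_in_polys) simp_all
    then show ?thesis
      by (simp add: x_def)
  qed
  define Y where "Y F y \<longleftrightarrow>
    (\<forall>l<rk (Suc (Suc i)). y l \<in> polys V) \<and> (\<forall>l<rk (Suc i). x F l = app (Suc i) y l)" for F y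
  have "\<exists>y. Y F y" if F: "F \<subseteq> V" for F
  proof (rule app_exact[of i "x F"])
    show "x F l \<in> polys V" if "l < rk (Suc i)" for l
      using x F that by blast
    show "app i (x F) r = 0" if "r < rk i" for r
      using app_h F that by (simp add: x_def[abs_def] app_diff kos_app)
  qed (unfold Y_def, blast)
  then obtain y where "\<And>F. F \<subseteq> V \<Longrightarrow> Y F (y F)"
    by metis
  then have y: "\<And>F l. F \<subseteq> V \<Longrightarrow> l < rk (Suc (Suc i)) \<Longrightarrow> y F l \<in> polys V"
    and x_y: "\<And>F l. F \<subseteq> V \<Longrightarrow> l < rk (Suc i) \<Longrightarrow> x F l = app (Suc i) (y F) l"
    by (simp_all add: Y_def)
  have "app (Suc i) (b F) l = kos var (\<lambda>F. app (Suc i) (y F) l) F"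
    if "F \<subseteq> V" "l < rk (Suc i)" for F l
  proof -
    have "kos var (\<lambda>F. app (Suc i) (y F) l) F = kos var (\<lambda>F. h l F - kos var (\<lambda>F. b' F l) F) F"
      using that x_y by (intro kos_cong) (auto simp: x_def)
    then show ?thesis
      using kos_h[OF that(2,1)] by (simp add: kos_diff kos_kos)
  qed
  then show "\<exists>b'. (\<forall>F\<subseteq>V. \<forall>l<rk (Suc (Suc i)). b' F l \<in> polys V) \<and>
      (\<forall>F\<subseteq>V. \<forall>r<rk (Suc i). app (Suc i) (b F) r = kos var (\<lambda>F. app (Suc i) (b' F) r) F)"
    using y by blast
qed

text \<open>A Nakayama argument. The image of a basis element of too large degree, placed on the
  empty set, would be a Koszul boundary. Then the basis element would agree with a combination
  without constant terms up to a kernel element, and by minimality the kernel has no constant terms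
  either.\<close>

lemma degree_bound:
  assumes ex: "koszul_exact s 0" and l: "l < rk (Suc i)"
  shows "A (Suc i) l < int i + s"
proof (rule ccontr)
  assume "\<not> ?thesis"
  then have l_deg: "A (Suc i) l \<ge> int i + s"
    by simp
  have ex_i: "koszul_exact s i"
    by (induction i) (use ex koszul_exact_Suc in auto)
  define \<delta> where "\<delta> k = (if k = l then 1 else 0 :: ('v, 'k) mpol)" for k
  define b where "b F = (if F = {} then \<delta> else (\<lambda>_. 0))" for F :: "'v set"
  have app_b: "app i (b F) r = (if F = {} then d i r l else 0)" for F r
    using l by (simp add: app_def b_def \<delta>_def if_distrib[of "(*) _"] cong: if_cong)
  have "b F k \<in> polys V" for F k
    by (simp add: b_def \<delta>_def polys_closed)
  \<comment> \<open>The chain lives on the empty set alone, while \<open>kos\<close> evaluates it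
    only at sets of the form \<open>insert v F\<close>.\<close>
  moreover have "kos var (\<lambda>F. app i (b F) r) F = 0" for F r
    by (simp add: app_b kos_def)
  moreover have "int (monom_deg m) + A i r \<ge> int i + s"
    if "r < rk i" "m \<in> keys (app i (b F) r)" for F r m
    using that d_homogeneous[OF that(1) l] l_deg by (auto simp: app_b homogeneous_def split: if_splits)
  ultimately obtain b' where
      b': "\<forall>F\<subseteq>V. \<forall>k<rk (Suc i). b' F k \<in> polys V"
      and app_b': "\<forall>F\<subseteq>V. \<forall>r<rk i. app i (b F) r = kos var (\<lambda>F. app i (b' F) r) F"
    using koszul_exactD[OF ex_i, of b] by auto
  define x where "x k = \<delta> k - kos var (\<lambda>F. b' F k) {}" for k
  obtain y where "x l = app (Suc i) y l"
  proof (rule app_exact[of i x])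
    show "x k \<in> polys V" if "k < rk (Suc i)" for k
    proof -
      have "\<delta> k + - kos var (\<lambda>F. b' F k) {} \<in> polys V"
        using b' that by (intro polys_closed kos_in_polys) (simp_all add: \<delta>_def polys_closed)
      then show ?thesis
        by (simp add: x_def)
    qed
    show "app i x r = 0" if "r < rk i" for r
      using app_b'[rule_format, of "{}" r] that by (simp add: x_def[abs_def] app_diff kos_app b_def)
  qed (use l in blast)
  \<comment> \<open>This contradicts the definition of \<open>x\<close>: the constant term of
    \<open>\<delta> l\<close> is 1, and Koszul boundaries have none.\<close>
  then have "lookup (x l) 0 = 0"
    using l by (simp add: lookup_app_const)
  then show False
    by (simp add: x_def \<delta>_def lookup_minus lookup_kos_const)
qed

text \<open>The base of the dimension shift. Position 0 is the ring with its generator in degree 0,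
  and the image of \<open>app 0\<close> is the ideal. The bounding chain with values in the edge
  ideal is lifted to coefficient vectors on the generators.\<close>

lemma koszul_exact_0:
  assumes G: "simple_graph V E" "claw_free V E" "\<not> has_induced_4_cycle V (complement_edges V E)"
    and I: "I = edge_ideal V E"
  shows "koszul_exact 4 0"
  unfolding koszul_exact_def
proof (intro allI impI)
  fix b :: "'v set \<Rightarrow> nat \<Rightarrow> ('v, 'k) mpol"
  assume b: "\<forall>F\<subseteq>V. \<forall>l<rk (Suc 0). b F l \<in> polys V"
    and cyc: "\<forall>F\<subseteq>V. \<forall>r<rk 0. kos var (\<lambda>F. app 0 (b F) r) F = 0"
    and deg: "\<forall>F\<subseteq>V. \<forall>r<rk 0. \<forall>m\<in>keys (app 0 (b F) r). int (monom_deg m) + A 0 r \<ge> int 0 + 4"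
  have image': "p \<in> edge_ideal V E \<longleftrightarrow> (\<exists>x. (\<forall>l<rk (Suc 0). x l \<in> polys V) \<and> p = app 0 x 0)" for p
    using image[of p] by (simp add: I app_def)
  obtain c where
      c: "\<forall>F\<subseteq>V. c F \<in> edge_ideal V E" and kos_c: "\<forall>F\<subseteq>V. kos var c F = app 0 (b F) 0"
  proof (rule koszul_exact_edge_ideal[OF G, of "\<lambda>F. app 0 (b F) 0"])
    show "app 0 (b F) 0 \<in> edge_ideal V E" if "F \<subseteq> V" for F
      using b that image' by blast
    show "4 \<le> int (monom_deg m)" if "F \<subseteq> V" "m \<in> keys (app 0 (b F) 0)" for F m
      using deg[rule_format, OF that(1) _ that(2)] A_0 rk_0 by simp
    show "kos var (\<lambda>F. app 0 (b F) 0) F = 0" if "F \<subseteq> V" for F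
      using cyc that rk_0 by simp
    fix c :: "'v set \<Rightarrow> ('v, 'k) mpol"
    assume "\<And>F. F \<subseteq> V \<Longrightarrow> c F \<in> edge_ideal V E"
      and "\<And>F. F \<subseteq> V \<Longrightarrow> kos var c F = app 0 (b F) 0"
    then show thesis
      by (intro that[of c]) simp_all
  qed
  define P where "P F x \<longleftrightarrow> (\<forall>l<rk (Suc 0). x l \<in> polys V) \<and> c F = app 0 x 0" for F x
  have "\<exists>x. P F x" if "F \<subseteq> V" for F
    unfolding P_def using c that image' by blast
  then obtain b' where "\<And>F. F \<subseteq> V \<Longrightarrow> P F (b' F)"
    by metis
  then have b': "\<And>F l. F \<subseteq> V \<Longrightarrow> l < rk (Suc 0) \<Longrightarrow> b' F l \<in> polys V"
    and c_b': "\<And>F. F \<subseteq> V \<Longrightarrow> c F = app 0 (b' F) 0"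
    by (simp_all add: P_def)
  have "app 0 (b F) 0 = kos var (\<lambda>F. app 0 (b' F) 0) F" if "F \<subseteq> V" for F
    using kos_c that kos_cong[of c "\<lambda>F. app 0 (b' F) 0" F var] c_b' by simp
  then show "\<exists>b'. (\<forall>F\<subseteq>V. \<forall>l<rk (Suc 0). b' F l \<in> polys V) \<and>
      (\<forall>F\<subseteq>V. \<forall>r<rk 0. app 0 (b F) r = kos var (\<lambda>F. app 0 (b' F) r) F)"
    using b' by (intro exI[of _ b']) (auto simp: rk_0)
qed

end

section \<open>From matrices to the locale, and the regularity bound\<close>

lemma mult_mat_vec_index:
  assumes "M \<in> carrier_mat nr nc" "x \<in> carrier_vec nc" "r < nr"
  shows "(M *\<^sub>v x) $ r = (\<Sum>l<nc. M $$ (r, l) * x $ l)"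
  using assms by (auto simp: scalar_prod_def atLeast0LessThan intro!: sum.cong)

lemma vec_in_free_mod: "vec n x \<in> free_mod V n \<longleftrightarrow> (\<forall>l<n. x l \<in> polys V)"
  by (auto simp: free_mod_def vec_set_def)

text \<open>\<open>case_nat\<close> puts the ring, of rank 1 and generated in degree 0, in front of
  the resolution. The augmentation row \<open>D 0\<close> then becomes an ordinary differential, and
  vectors are replaced by their entry functions.\<close>

lemma minimal_resolutionI:
  fixes D :: "nat \<Rightarrow> ('v, 'k::field) mpol mat"
  assumes V: "finite V" "inj_on idx V" and min: "minimal_graded_free_resolution V I n a D"
  shows "minimal_resolution V idx I (case_nat 1 n) (case_nat (\<lambda>_. 0) a) (\<lambda>i r l. D i $$ (r, l))"
proof -
  define rk where "rk = case_nat 1 n"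
  have rk: "rk 0 = 1" "rk (Suc i) = n i" for i
    by (simp_all add: rk_def)
  note res = min[unfolded minimal_graded_free_resolution_def graded_free_resolution_def]
  have D: "D i \<in> carrier_mat (rk i) (rk (Suc i))" for i
    using res by (cases i) (auto simp: rk)
  have app: "(D i *\<^sub>v vec (n i) x) $ r = (\<Sum>l<rk (Suc i). D i $$ (r, l) * x l)" if "r < rk i" for i r x
    using mult_mat_vec_index[OF D _ that, of "vec (n i) x"] by (simp add: rk)
  have elem: "D i $$ (r, l) \<in> elements_mat (D i)" if "r < rk i" "l < rk (Suc i)" for i r l
    using D[of i] that by (auto simp: elements_mat_def intro!: bexI[of _ r] image_eqI[of _ _ l])
  have free_vec: "\<exists>x. y = vec (n i) x \<and> (\<forall>l<n i. x l \<in> polys V)" if "y \<in> free_mod V (n i)" for y i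
  proof -
    have "y = vec (n i) (($) y)"
      using that by (auto simp: free_mod_def)
    then show ?thesis
      using that by (metis vec_in_free_mod)
  qed
  have ker: "vec (n i) x \<in> mat_kernel (D i) \<longleftrightarrow> (\<forall>r<rk i. (\<Sum>l<rk (Suc i). D i $$ (r, l) * x l) = 0)"
    for i x
  proof -
    have "vec (n i) x \<in> mat_kernel (D i) \<longleftrightarrow> D i *\<^sub>v vec (n i) x = 0\<^sub>v (rk i)"
      using D[of i] by (auto simp: mat_kernel_def rk)
    also have "\<dots> \<longleftrightarrow> (\<forall>r<rk i. (D i *\<^sub>v vec (n i) x) $ r = 0)"
    proof (intro iffI allI impI)
      show "(D i *\<^sub>v vec (n i) x) $ r = 0" if "D i *\<^sub>v vec (n i) x = 0\<^sub>v (rk i)" "r < rk i" for r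
        unfolding that(1) using that(2) by simp
    qed (use D[of i] in \<open>auto intro!: eq_vecI\<close>)
    also have "\<dots> \<longleftrightarrow> (\<forall>r<rk i. (\<Sum>l<rk (Suc i). D i $$ (r, l) * x l) = 0)"
      by (intro all_cong) (simp only: app)
    finally show ?thesis .
  qed
  have exact: "mat_kernel (D i) \<inter> free_mod V (n i) = (\<lambda>x. D (Suc i) *\<^sub>v x) ` free_mod V (n (Suc i))" for i
    using res by blast
  show ?thesis
    unfolding rk_def[symmetric]
  proof
    show "finite V" "inj_on idx V"
      by (fact V)+
    show "rk 0 = 1" "case_nat (\<lambda>_. 0) a 0 0 = (0 :: int)"
      by (simp_all add: rk)
    show "D i $$ (r, l) \<in> polys V" if "r < rk i" "l < rk (Suc i)" for i r l
      using elem[OF that] res by blast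
    show "homogeneous (case_nat (\<lambda>_. 0) a (Suc i) l - case_nat (\<lambda>_. 0) a i r) (D i $$ (r, l))"
      if "r < rk i" "l < rk (Suc i)" for i r l
      using that res by (cases i) (auto simp: rk)
    show "lookup (D (Suc i) $$ (r, l)) 0 = 0" if "r < rk (Suc i)" "l < rk (Suc (Suc i))" for i r l
    proof -
      have "elements_mat (D (Suc i)) \<subseteq> irrelevant_ideal V"
        using min by (simp add: minimal_graded_free_resolution_def)
      then show ?thesis
        using elem[OF that] irrelevant_ideal_const by blast
    qed
    show "p \<in> I \<longleftrightarrow> (\<exists>x. (\<forall>l<rk 1. x l \<in> polys V) \<and> p = (\<Sum>l<rk 1. D 0 $$ (0, l) * x l))" for p
    proof -
      have I: "I = (\<lambda>x. (D 0 *\<^sub>v x) $ 0) ` free_mod V (n 0)"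
        using res by blast
      have "p \<in> I \<longleftrightarrow> (\<exists>x. vec (n 0) x \<in> free_mod V (n 0) \<and> p = (D 0 *\<^sub>v vec (n 0) x) $ 0)"
        unfolding I using free_vec[of _ 0] by (fastforce simp: vec_in_free_mod)
      then show ?thesis
        by (simp add: app rk vec_in_free_mod)
    qed
    show "(\<Sum>k<rk (Suc i). D i $$ (r, k) * (\<Sum>l<rk (Suc (Suc i)). D (Suc i) $$ (k, l) * y l)) = 0"
      if y: "\<And>l. l < rk (Suc (Suc i)) \<Longrightarrow> y l \<in> polys V" and r: "r < rk i" for i r y
    proof -
      let ?x = "\<lambda>k. \<Sum>l<rk (Suc (Suc i)). D (Suc i) $$ (k, l) * y l"
      have "D (Suc i) *\<^sub>v vec (n (Suc i)) y = vec (n i) ?x"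
        using D[of "Suc i"] app[of _ "Suc i" y] by (intro eq_vecI) (auto simp: rk)
      moreover have "D (Suc i) *\<^sub>v vec (n (Suc i)) y \<in> mat_kernel (D i) \<inter> free_mod V (n i)"
        unfolding exact using y by (intro imageI) (simp add: vec_in_free_mod rk)
      ultimately have "vec (n i) ?x \<in> mat_kernel (D i)"
        by simp
      then show ?thesis
        using r unfolding ker by blast
    qed
    show "\<exists>y. (\<forall>l<rk (Suc (Suc i)). y l \<in> polys V) \<and>
        (\<forall>l<rk (Suc i). x l = (\<Sum>k<rk (Suc (Suc i)). D (Suc i) $$ (l, k) * y k))"
      if x: "\<And>l. l < rk (Suc i) \<Longrightarrow> x l \<in> polys V"
        and zero: "\<And>r. r < rk i \<Longrightarrow> (\<Sum>l<rk (Suc i). D i $$ (r, l) * x l) = 0" for i x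
    proof -
      have "vec (n i) x \<in> mat_kernel (D i) \<inter> free_mod V (n i)"
        using x zero by (auto simp: ker vec_in_free_mod rk)
      then obtain z where z: "z \<in> free_mod V (n (Suc i))" "vec (n i) x = D (Suc i) *\<^sub>v z"
        unfolding exact by blast
      then obtain y where y: "z = vec (n (Suc i)) y" "\<forall>l<n (Suc i). y l \<in> polys V"
        using free_vec by blast
      have "x l = (\<Sum>k<rk (Suc (Suc i)). D (Suc i) $$ (l, k) * y k)" if "l < rk (Suc i)" for l
        using app[OF that, of y] z(2) y(1) that by (metis index_vec rk(2))
      then show ?thesis
        using y(2) by (auto simp: rk)
    qed
  qed
qed

theorem theorem5p1:
  fixes V :: "'v set" and E :: "'v set set"
  assumes "simple_graph V E"
    and "claw_free V E"
    and "\<not> has_induced_4_cycle V (complement_edges V E)"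
  shows "regularity V (edge_ideal V E :: ('v, 'k::field) mpol set) \<le> 3"
proof -
  have "finite V"
    using assms(1) by (simp add: simple_graph_def)
  then obtain idx :: "'v \<Rightarrow> nat" where idx: "inj_on idx V"
    using finite_imp_inj_to_nat_seg by blast
  have bound: "j - int i \<le> 3"
    if min: "minimal_graded_free_resolution V (edge_ideal V E :: ('v, 'k) mpol set) n a D"
      and "res_betti n a i j \<noteq> 0" for i j n a D
  proof -
    have "{l. l < n i \<and> a i l = j} \<noteq> {}"
      using that(2) unfolding res_betti_def by (metis card.empty)
    then obtain l where l: "l < n i" "a i l = j"
      by blast
    interpret minimal_resolution V idx "edge_ideal V E" "case_nat 1 n" "case_nat (\<lambda>_. 0) a"
        "\<lambda>i r l. D i $$ (r, l)"
      using \<open>finite V\<close> idx min by (rule minimal_resolutionI)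
    \<comment> \<open>Position \<open>Suc i\<close> of the locale is the i-th free module of the
      resolution. The strict bound \<open>a i l < i + 4\<close> gives the value 3.\<close>
    show ?thesis
      using degree_bound[OF koszul_exact_0[OF assms refl], of l i] l by simp
  qed
  show ?thesis
    unfolding regularity_def
  proof (rule Sup_least)
    fix x
    assume "x \<in> {ereal (real_of_int (j - int i)) | i j. \<exists>n a D.
      minimal_graded_free_resolution V (edge_ideal V E :: ('v, 'k) mpol set) n a D \<and> res_betti n a i j \<noteq> 0}"
    then obtain i j n a D where x: "x = ereal (real_of_int (j - int i))"
        and "minimal_graded_free_resolution V (edge_ideal V E :: ('v, 'k) mpol set) n a D"
        and "res_betti n a i j \<noteq> 0"
      by blast
    from this(2,3) have "j - int i \<le> 3"
      by (rule bound)
    then have "real_of_int (j - int i) \<le> 3"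
      by linarith
    then have "x \<le> ereal 3"
      by (simp only: x ereal_less_eq)
    then show "x \<le> 3"
      by simp
  qed
qed

end
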